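(* Let $d\ge 2$ and $t\ge 1$ be integers and let $\{|k,m,\lambda\rangle\}$ be a Schur basis of $(\mathbb C^d)^{\otimes t}$ as described in the context, with associated operators $\hat\Pi_k^{\lambda_1\lambda_2}$, $\hat\Pi_k$, dimensions $D^k_L$, $D^k_V$, $D^k=D^k_LD^k_V$ and maps $\mathcal T_{\mathrm U}^{(k)}$. Let $d\mu(A)$ be an arbitrary normalised (probability) measure on $\mathbb A$, and let $\mathcal T_{\mathrm{SL}}$ be the collective SLOCC twirling map $$\mathcal T_{\mathrm{SL}}(\rho)=\int \big(KA_{\mathrm n}K'\big)^{\otimes t}\rho\,\big(KA_{\mathrm n}K'\big)^{\dagger\otimes t}\,d\mu(K)\,d\mu(A)\,d\mu(K'),$$ where $K,K'\in\mathrm{SU}(d)$ are integrated against the normalised Haar measure $d\mu$ on $\mathrm{SU}(d)$, $A\in\mathbb A$ and $A_{\mathrm n}=A/\|A\|$. Then for every density operator $\rho$ on $(\mathbb C^d)^{\otimes t}$: $$\mathcal T_{\mathrm{SL}}(\rho)=\sum_k\left(\frac{\beta_k}{D^k}\right)\mathcal T_{\mathrm U}^{(k)}(\rho),\qquad \beta_k=\operatorname{Tr}\!\left(\left[\int\big(A_{\mathrm n}^{\otimes t}\big)^2d\mu(A)\right]\hat\Pi_k^\dagger\right).$$ Moreover, the average success probability $\langle p_M(\rho)\rangle:=\operatorname{Tr}(\mathcal T_{\mathrm{SL}}(\rho))$ equals $\sum_k\left(\frac{\beta_k}{D^k}\right)\operatorname{Tr}\left(\rho\hat\Pi_k^\dagger\right)$,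 and for every positive integer $m$ the $m$-fold composition $\mathcal T_{\mathrm{SL}}^m=\mathcal T_{\mathrm{SL}}\circ\cdots\circ\mathcal T_{\mathrm{SL}}$ satisfies $$\mathcal T_{\mathrm{SL}}^m(\rho)=\sum_k\left(\frac{\beta_k}{D^k}\right)^m\mathcal T_{\mathrm U}^{(k)}(\rho).$$
   Context: For a permutation $p$ of $\{1,\dots,t\}$, $O_p$ denotes the (real orthogonal) operator on $(\mathbb C^d)^{\otimes t}$ permuting tensor factors: $O_p(|v_1\rangle\otimes\cdots\otimes|v_t\rangle)=|v_{p^{-1}(1)}\rangle\otimes\cdots\otimes|v_{p^{-1}(t)}\rangle$. A Schur basis is an orthonormal basis $\{|k,m,\lambda\rangle\}$ of $(\mathbb C^d)^{\otimes t}$, where $k$ runs over Young diagrams with $t$ boxes and at most $d$ rows, $m=1,\dots,D^k_L$, $\lambda=1,\dots,D^k_V$, such that under the identification $|k,m,\lambda\rangle\leftrightarrow |m\rangle\otimes|\lambda\rangle\in\mathbb C^{D^k_L}\otimes\mathbb C^{D^k_V}$ (Schur–Weyl decomposition $(\mathbb C^d)^{\otimes t}\cong\bigoplus_k\mathbb C^{D^k_L}\otimes\mathbb C^{D^k_V}$), every $X^{\otimes t}$ with $X\in\mathrm{GL}(d,\mathbb C)$ acts as $\bigoplus_k\pi_k(X)\otimes I$ and every $O_p$ acts as $\bigoplus_k I\otimes\sigma_k(p)$, where the $\pi_k$ are pairwise inequivalent irreducible representations (irreducible also when restricted to $\mathrm U(d)$) and the $\sigma_k$ are pairwise inequivalent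 irreducible representations of the symmetric group $S_t$. Define $\hat\Pi_k^{\lambda_1\lambda_2}=\sum_{m=1}^{D^k_L}|k,m,\lambda_1\rangle\langle k,m,\lambda_2|$, $\hat\Pi_k=\sum_{m,\lambda}|k,m,\lambda\rangle\langle k,m,\lambda|$ (orthogonal projector onto the $k$-th isotypic subspace), $D^k=D^k_LD^k_V$, and $$\mathcal T_{\mathrm U}^{(k)}(\rho)=\frac{1}{D^k_L}\sum_{\lambda_1,\lambda_2=1}^{D^k_V}\operatorname{Tr}\left(\rho\,\hat\Pi_k^{\lambda_1\lambda_2\dagger}\right)\hat\Pi_k^{\lambda_1\lambda_2}.$$ $\mathbb A$ denotes the group of diagonal $d\times d$ matrices with positive real diagonal entries and determinant $1$, so that every $M\in\mathrm{SL}(d,\mathbb C)$ can be written $M=KAK'$ with $K,K'\in\mathrm{SU}(d)$, $A\in\mathbb A$ (Cartan/singular value decomposition). $\|\cdot\|$ is the operator norm (largest singular value). *)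

theory Defs
  imports "HOL-Probability.Probability"
begin

text \<open>Basis index of (C^d)^(tensor t): tuples (i_0,...,i_{t-1}) of elements of 'd,
  represented as extensional functions on {..<t}.  Vectors are functions
  index => complex, operators are index => index => complex (matrices in the
  product basis); only entries on the index set matter.\<close>

type_synonym 'd tidx = "nat \<Rightarrow> 'd"
type_synonym 'd tvec = "'d tidx \<Rightarrow> complex"
type_synonym 'd top = "'d tidx \<Rightarrow> 'd tidx \<Rightarrow> complex"

definition tidx :: "nat \<Rightarrow> ('d::finite) tidx set" where
  "tidx t = PiE {..<t} (\<lambda>_. UNIV)"

definition opmul :: "nat \<Rightarrow> ('d::finite) top \<Rightarrow> 'd top \<Rightarrow> 'd top" where
  "opmul t M N = (\<lambda>i j. \<Sum>l\<in>tidx t. M i l * N l j)"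

definition opadj :: "('d::finite) top \<Rightarrow> 'd top" where
  "opadj M = (\<lambda>i j. cnj (M j i))"

definition optr :: "nat \<Rightarrow> ('d::finite) top \<Rightarrow> complex" where
  "optr t M = (\<Sum>i\<in>tidx t. M i i)"

definition opapp :: "nat \<Rightarrow> ('d::finite) top \<Rightarrow> 'd tvec \<Rightarrow> 'd tvec" where
  "opapp t M v = (\<lambda>i. \<Sum>j\<in>tidx t. M i j * v j)"

definition vinner :: "nat \<Rightarrow> ('d::finite) tvec \<Rightarrow> 'd tvec \<Rightarrow> complex" where
  "vinner t v w = (\<Sum>i\<in>tidx t. cnj (v i) * w i)"

definition tpow :: "nat \<Rightarrow> complex^'d^'d \<Rightarrow> ('d::finite) top" where
  "tpow t X = (\<lambda>i j. \<Prod>s<t. X $ (i s) $ (j s))"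

text \<open>O_p (v_1 x ... x v_t) = v_{p^-1(1)} x ... x v_{p^-1(t)}, factors indexed 0..t-1.\<close>
definition permop :: "nat \<Rightarrow> (nat \<Rightarrow> nat) \<Rightarrow> ('d::finite) top" where
  "permop t p = (\<lambda>i j. if (\<forall>s<t. i s = j (inv p s)) then 1 else 0)"

definition density_op :: "nat \<Rightarrow> ('d::finite) top \<Rightarrow> bool" where
  "density_op t \<rho> \<longleftrightarrow>
     (\<forall>v. vinner t v (opapp t \<rho> v) \<in> \<real> \<and> Re (vinner t v (opapp t \<rho> v)) \<ge> 0)
     \<and> optr t \<rho> = 1"

definition adjm :: "complex^'n^'n \<Rightarrow> complex^'n^'n" where
  "adjm U = (\<chi> i j. cnj (U $ j $ i))"

definition GLset :: "(complex^'n^'n) set" where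
  "GLset = {X. det X \<noteq> 0}"

definition Uset :: "(complex^'n^'n) set" where
  "Uset = {U. U ** adjm U = mat 1}"

definition SUset :: "(complex^'n^'n) set" where
  "SUset = {U. U ** adjm U = mat 1 \<and> det U = 1}"

definition Aset :: "(complex^'n^'n) set" where
  "Aset = {A. (\<forall>i j. i \<noteq> j \<longrightarrow> A $ i $ j = 0)
             \<and> (\<forall>i. A $ i $ i \<in> \<real> \<and> Re (A $ i $ i) > 0) \<and> det A = 1}"

definition normA :: "complex^'n^'n \<Rightarrow> complex^'n^'n" where
  "normA A = (1 / onorm (\<lambda>x::complex^'n. A *v x)) *\<^sub>R A"

definition haar_SU :: "(complex^'n^'n) measure \<Rightarrow> bool" where
  "haar_SU \<mu> \<longleftrightarrow> prob_space \<mu> \<and> sets \<mu> = sets borel \<and> (AE K in \<mu>. K \<in> SUset)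
     \<and> (\<forall>U\<in>SUset. distr \<mu> borel (\<lambda>K. U ** K) = \<mu>)"

definition smat_mul :: "nat \<Rightarrow> (nat \<Rightarrow> nat \<Rightarrow> complex) \<Rightarrow> (nat \<Rightarrow> nat \<Rightarrow> complex) \<Rightarrow> nat \<Rightarrow> nat \<Rightarrow> complex" where
  "smat_mul n A B = (\<lambda>i j. \<Sum>l=1..n. A i l * B l j)"

definition smat_vec :: "nat \<Rightarrow> (nat \<Rightarrow> nat \<Rightarrow> complex) \<Rightarrow> (nat \<Rightarrow> complex) \<Rightarrow> nat \<Rightarrow> complex" where
  "smat_vec n A v = (\<lambda>i. if i \<in> {1..n} then \<Sum>j=1..n. A i j * v j else 0)"

definition smat_eq :: "nat \<Rightarrow> (nat \<Rightarrow> nat \<Rightarrow> complex) \<Rightarrow> (nat \<Rightarrow> nat \<Rightarrow> complex) \<Rightarrow> bool" where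
  "smat_eq n A B \<longleftrightarrow> (\<forall>i\<in>{1..n}. \<forall>j\<in>{1..n}. A i j = B i j)"

definition smat_id :: "nat \<Rightarrow> nat \<Rightarrow> complex" where
  "smat_id = (\<lambda>i j. if i = j then 1 else 0)"

definition cspace :: "nat \<Rightarrow> (nat \<Rightarrow> complex) set" where
  "cspace n = {v. \<forall>i. i \<notin> {1..n} \<longrightarrow> v i = 0}"

definition csubspace :: "nat \<Rightarrow> (nat \<Rightarrow> complex) set \<Rightarrow> bool" where
  "csubspace n W \<longleftrightarrow> W \<subseteq> cspace n \<and> (\<lambda>_. 0) \<in> W
     \<and> (\<forall>v\<in>W. \<forall>w\<in>W. (\<lambda>i. v i + w i) \<in> W) \<and> (\<forall>c. \<forall>v\<in>W. (\<lambda>i. c * v i) \<in> W)"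

definition irreducible_rep :: "nat \<Rightarrow> 'g set \<Rightarrow> ('g \<Rightarrow> nat \<Rightarrow> nat \<Rightarrow> complex) \<Rightarrow> bool" where
  "irreducible_rep n G \<rho> \<longleftrightarrow> 0 < n \<and>
     (\<forall>W. csubspace n W \<and> (\<forall>g\<in>G. \<forall>v\<in>W. smat_vec n (\<rho> g) v \<in> W)
          \<longrightarrow> W = {\<lambda>_. 0} \<or> W = cspace n)"

definition equivalent_rep :: "nat \<Rightarrow> nat \<Rightarrow> 'g set \<Rightarrow> ('g \<Rightarrow> nat \<Rightarrow> nat \<Rightarrow> complex)
     \<Rightarrow> ('g \<Rightarrow> nat \<Rightarrow> nat \<Rightarrow> complex) \<Rightarrow> bool" where
  "equivalent_rep n1 n2 G \<rho>1 \<rho>2 \<longleftrightarrow> n1 = n2 \<and>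
     (\<exists>S T. smat_eq n1 (smat_mul n1 S T) smat_id \<and> smat_eq n1 (smat_mul n1 T S) smat_id
        \<and> (\<forall>g\<in>G. smat_eq n1 (smat_mul n1 S (\<rho>1 g)) (smat_mul n1 (\<rho>2 g) S)))"

definition young_diagrams :: "nat \<Rightarrow> nat \<Rightarrow> nat list set" where
  "young_diagrams t d = {k. sorted_wrt (\<ge>) k \<and> (\<forall>x\<in>set k. 0 < x) \<and> sum_list k = t \<and> length k \<le> d}"

definition Perms :: "nat \<Rightarrow> (nat \<Rightarrow> nat) set" where
  "Perms t = {p. p permutes {..<t}}"

definition schur_basis :: "nat \<Rightarrow> (nat list \<Rightarrow> nat) \<Rightarrow> (nat list \<Rightarrow> nat)
    \<Rightarrow> (nat list \<Rightarrow> nat \<Rightarrow> nat \<Rightarrow> ('d::finite) tvec)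
    \<Rightarrow> (nat list \<Rightarrow> complex^'d^'d \<Rightarrow> nat \<Rightarrow> nat \<Rightarrow> complex)
    \<Rightarrow> (nat list \<Rightarrow> (nat \<Rightarrow> nat) \<Rightarrow> nat \<Rightarrow> nat \<Rightarrow> complex) \<Rightarrow> bool" where
  "schur_basis t DL DV b \<pi> \<sigma> \<longleftrightarrow>
    (let Y = young_diagrams t CARD('d) in
     (\<forall>k\<in>Y. \<forall>m\<in>{1..DL k}. \<forall>l\<in>{1..DV k}. \<forall>k'\<in>Y. \<forall>m'\<in>{1..DL k'}. \<forall>l'\<in>{1..DV k'}.
        vinner t (b k m l) (b k' m' l') = (if k = k' \<and> m = m' \<and> l = l' then 1 else 0))
     \<and> (\<forall>v. \<forall>i\<in>tidx t. v i = (\<Sum>k\<in>Y. \<Sum>m=1..DL k. \<Sum>l=1..DV k. vinner t (b k m l) v * b k m l i))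
     \<and> (\<forall>k\<in>Y. \<forall>X\<in>GLset. \<forall>m\<in>{1..DL k}. \<forall>l\<in>{1..DV k}. \<forall>i\<in>tidx t.
          opapp t (tpow t X) (b k m l) i = (\<Sum>m'=1..DL k. \<pi> k X m' m * b k m' l i))
     \<and> (\<forall>k\<in>Y. \<forall>p\<in>Perms t. \<forall>m\<in>{1..DL k}. \<forall>l\<in>{1..DV k}. \<forall>i\<in>tidx t.
          opapp t (permop t p) (b k m l) i = (\<Sum>l'=1..DV k. \<sigma> k p l' l * b k m l' i))
     \<and> (\<forall>k\<in>Y. irreducible_rep (DL k) GLset (\<pi> k) \<and> irreducible_rep (DL k) Uset (\<pi> k))
     \<and> (\<forall>k\<in>Y. irreducible_rep (DV k) (Perms t) (\<sigma> k))
     \<and> (\<forall>k\<in>Y. \<forall>k'\<in>Y. k \<noteq> k' \<longrightarrow> \<not> equivalent_rep (DL k) (DL k') GLset (\<pi> k) (\<pi> k'))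
     \<and> (\<forall>k\<in>Y. \<forall>k'\<in>Y. k \<noteq> k' \<longrightarrow> \<not> equivalent_rep (DV k) (DV k') (Perms t) (\<sigma> k) (\<sigma> k')))"

definition Pi_ll :: "(nat list \<Rightarrow> nat) \<Rightarrow> (nat list \<Rightarrow> nat \<Rightarrow> nat \<Rightarrow> ('d::finite) tvec)
    \<Rightarrow> nat list \<Rightarrow> nat \<Rightarrow> nat \<Rightarrow> 'd top" where
  "Pi_ll DL b k l1 l2 = (\<lambda>i j. \<Sum>m=1..DL k. b k m l1 i * cnj (b k m l2 j))"

definition Pi_k :: "(nat list \<Rightarrow> nat) \<Rightarrow> (nat list \<Rightarrow> nat) \<Rightarrow> (nat list \<Rightarrow> nat \<Rightarrow> nat \<Rightarrow> ('d::finite) tvec)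
    \<Rightarrow> nat list \<Rightarrow> 'd top" where
  "Pi_k DL DV b k = (\<lambda>i j. \<Sum>m=1..DL k. \<Sum>l=1..DV k. b k m l i * cnj (b k m l j))"

definition TU :: "nat \<Rightarrow> (nat list \<Rightarrow> nat) \<Rightarrow> (nat list \<Rightarrow> nat) \<Rightarrow> (nat list \<Rightarrow> nat \<Rightarrow> nat \<Rightarrow> ('d::finite) tvec)
    \<Rightarrow> nat list \<Rightarrow> 'd top \<Rightarrow> 'd top" where
  "TU t DL DV b k \<rho> = (\<lambda>i j. (1 / of_nat (DL k)) *
      (\<Sum>l1=1..DV k. \<Sum>l2=1..DV k.
         optr t (opmul t \<rho> (opadj (Pi_ll DL b k l1 l2))) * Pi_ll DL b k l1 l2 i j))"

definition TSL :: "nat \<Rightarrow> (complex^'d^'d) measure \<Rightarrow> (complex^'d^'d) measure \<Rightarrow> ('d::finite) top \<Rightarrow> 'd top" where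
  "TSL t muH muA \<rho> = (\<lambda>i j. integral\<^sup>L (muH \<Otimes>\<^sub>M (muA \<Otimes>\<^sub>M muH))
      (\<lambda>(K, A, K'). opmul t (opmul t (tpow t (K ** normA A ** K')) \<rho>)
                             (tpow t (adjm (K ** normA A ** K'))) i j))"

definition beta :: "nat \<Rightarrow> (complex^'d^'d) measure \<Rightarrow> (nat list \<Rightarrow> nat) \<Rightarrow> (nat list \<Rightarrow> nat)
    \<Rightarrow> (nat list \<Rightarrow> nat \<Rightarrow> nat \<Rightarrow> ('d::finite) tvec) \<Rightarrow> nat list \<Rightarrow> complex" where
  "beta t muA DL DV b k = optr t (opmul t
      (\<lambda>i j. integral\<^sup>L muA (\<lambda>A. opmul t (tpow t (normA A)) (tpow t (normA A)) i j))
      (opadj (Pi_k DL DV b k)))"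

end

theory Submission
  imports "Jordan_Normal_Form.Spectral_Radius" Defs
begin

text \<open>Fubini factors the SLOCC twirl as a Haar twirl, then the average over \<open>A\<^sub>n\<close>, then a Haar twirl.
  The output of a Haar twirl commutes with the tensor powers of \<open>SU(d)\<close>, hence (unitarian trick) with
  those of all invertible matrices, so by Schur's lemma it is determined by its partial traces
  \<open>Tr(\<rho> Pi_ll\<^sup>\<dagger>)\<close> over the \<open>m\<close>-register. A Haar twirl preserves these partial traces, and the
  average over \<open>A\<^sub>n\<close> of a Haar-invariant operator multiplies them by the normalised trace
  \<open>\<beta>\<^sub>k / D\<^sup>k\<close> of \<open>\<pi>\<^sub>k(A\<^sub>n)\<^sup>\<dagger> \<pi>\<^sub>k(A\<^sub>n) = \<pi>\<^sub>k(A\<^sub>n\<^sup>2)\<close>.\<close>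

section \<open>Schur's lemma\<close>

hide_const (open) Matrix.mat
no_notation Matrix.vec_index (infixl "$" 100)

text \<open>The unitarian trick bridges a gap between two inputs: the \<open>\<pi> k\<close> are
  inequivalent over the invertible matrices, whereas Haar invariance gives commutation with SU(d)
  only. Each entry of a commutator with a tensor power is a polynomial in the matrix entries, so
  along a one-parameter polynomial family it vanishes identically once it has infinitely many zeros.
  Starting from unitaries of the form 1 + c v v^dagger, this reaches all 1 + a b^T, hence elementary
  matrices, hence GL(d). The average over A_n need not commute with SU(d), so the middle stage is
  followed only through its partial traces; the outer Haar twirl leaves these unchanged and restores
  the commutation under which they determine the operator. Powers follow because every application
  rescales the same numbers. In beta_k / D^k, the factor 1 / D_L is the Schur scalar (trace of a
  block over its size), and 1 / D_V compensates for beta_k adding up one and the same trace over all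
  values of lambda.\<close>

lemma smat_eigenvector_exists:
  fixes S :: "nat \<Rightarrow> nat \<Rightarrow> complex"
  assumes "0 < n"
  shows "\<exists>c v. v \<in> cspace n \<and> v \<noteq> (\<lambda>_. 0) \<and> smat_vec n S v = (\<lambda>i. c * v i)"
proof -
  \<comment> \<open>Entries are counted from 1 here and from 0 in \<open>carrier_mat\<close>, hence
    the shift by \<open>Suc\<close>. The spectrum is nonempty because the scalars are
    complex.\<close>
  define M where "M = Matrix.mat n n (\<lambda>(i,j). S (Suc i) (Suc j))"
  have M: "M \<in> carrier_mat n n" by (simp add: M_def)
  from spectrum_non_empty[OF M assms] obtain c where "eigenvalue M c"
    by (auto simp: spectrum_def)
  then obtain u where u: "u \<in> carrier_vec n" "u \<noteq> 0\<^sub>v n" "M *\<^sub>v u = c \<cdot>\<^sub>v u"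
    using M by (auto simp: eigenvalue_def eigenvector_def)
  define v where "v = (\<lambda>i. if i \<in> {1..n} then vec_index u (i - 1) else 0)"
  have "v \<in> cspace n" by (simp add: v_def cspace_def)
  moreover have "v \<noteq> (\<lambda>_. 0)"
  proof
    assume v0: "v = (\<lambda>_. 0)"
    have "vec_index u i = 0" if "i < n" for i
      using fun_cong[OF v0, of "Suc i"] that by (simp add: v_def)
    then have "u = 0\<^sub>v n" using u(1) by (intro eq_vecI) auto
    with u(2) show False by simp
  qed
  moreover have "smat_vec n S v = (\<lambda>i. c * v i)"
  proof
    fix i
    show "smat_vec n S v i = c * v i"
    proof (cases "i \<in> {1..n}")
      case True
      then obtain k where k: "i = Suc k" "k < n" by (cases i) auto
      have "c * vec_index u k = vec_index (M *\<^sub>v u) k" using u k by simp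
      also have "\<dots> = (\<Sum>j=0..<n. S (Suc k) (Suc j) * vec_index u j)"
        using k u(1) by (simp add: M_def scalar_prod_def)
      also have "\<dots> = (\<Sum>j=1..n. S (Suc k) j * v j)"
        by (rule sum.reindex_bij_witness[where i="\<lambda>j. j - 1" and j=Suc]) (auto simp: v_def)
      finally show ?thesis using k by (simp add: smat_vec_def v_def)
    qed (auto simp: smat_vec_def v_def)
  qed
  ultimately show ?thesis by blast
qed

lemma smat_vec_in_cspace: "smat_vec n A v \<in> cspace n"
  by (simp add: smat_vec_def cspace_def)

text \<open>An eigenspace of S is stable under every matrix commuting with S. It is nonzero, so
  irreducibility makes it the whole space.\<close>

lemma schur_scalar:
  assumes irr: "irreducible_rep n G \<rho>"
    and comm: "\<And>g i j. g \<in> G \<Longrightarrow> i \<in> {1..n} \<Longrightarrow> j \<in> {1..n} \<Longrightarrow>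
      (\<Sum>l=1..n. S i l * \<rho> g l j) = (\<Sum>l=1..n. \<rho> g i l * S l j)"
  shows "\<exists>c. \<forall>i\<in>{1..n}. \<forall>j\<in>{1..n}. S i j = (if i = j then c else 0)"
proof -
  have "0 < n" using irr by (simp add: irreducible_rep_def)
  then obtain c v where v: "v \<in> cspace n" "v \<noteq> (\<lambda>_. 0)" "smat_vec n S v = (\<lambda>i. c * v i)"
    using smat_eigenvector_exists by blast
  define W where "W = {v \<in> cspace n. smat_vec n S v = (\<lambda>i. c * v i)}"
  have "csubspace n W"
    unfolding csubspace_def W_def
    by (auto simp: cspace_def smat_vec_def fun_eq_iff algebra_simps sum.distrib split: if_splits
        simp flip: sum_distrib_left)
  moreover have "smat_vec n (\<rho> g) w \<in> W" if g: "g \<in> G" and w: "w \<in> W" for g w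
  proof -
    have "smat_vec n S (smat_vec n (\<rho> g) w) i = c * smat_vec n (\<rho> g) w i" for i
    proof (cases "i \<in> {1..n}")
      case True
      have "smat_vec n S (smat_vec n (\<rho> g) w) i = (\<Sum>l=1..n. \<Sum>j=1..n. S i l * \<rho> g l j * w j)"
        using True by (simp add: smat_vec_def sum_distrib_left mult.assoc)
      also have "\<dots> = (\<Sum>j=1..n. (\<Sum>l=1..n. S i l * \<rho> g l j) * w j)"
        by (subst sum.swap) (simp add: sum_distrib_right)
      also have "\<dots> = (\<Sum>j=1..n. (\<Sum>l=1..n. \<rho> g i l * S l j) * w j)"
        using comm[OF g True] by simp
      also have "\<dots> = (\<Sum>l=1..n. \<rho> g i l * (\<Sum>j=1..n. S l j * w j))"
        by (simp add: sum_distrib_right sum_distrib_left mult.assoc) (rule sum.swap)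
      also have "\<dots> = (\<Sum>l=1..n. \<rho> g i l * smat_vec n S w l)"
        by (simp add: smat_vec_def)
      also have "\<dots> = c * smat_vec n (\<rho> g) w i"
        using w True by (simp add: W_def smat_vec_def sum_distrib_left algebra_simps)
      finally show ?thesis .
    qed (auto simp: smat_vec_def)
    then show ?thesis by (auto simp: W_def smat_vec_in_cspace)
  qed
  ultimately have "W = {\<lambda>_. 0} \<or> W = cspace n"
    using irr unfolding irreducible_rep_def by blast
  with v have W: "W = cspace n" by (auto simp: W_def)
  have "S i j = (if i = j then c else 0)" if "i \<in> {1..n}" "j \<in> {1..n}" for i j
  proof -
    \<comment> \<open>Applying S to the unit vector at j reads off column j.\<close>
    have "(\<lambda>l. if l = j then 1 else 0) \<in> W" using that W by (auto simp: cspace_def)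
    then have "smat_vec n S (\<lambda>l. if l = j then 1 else 0) i = c * (if i = j then 1 else 0)"
      by (simp add: W_def)
    with that show ?thesis by (simp add: smat_vec_def if_distrib cong: if_cong)
  qed
  then show ?thesis by blast
qed

text \<open>Tr(S T) = Tr(T S), where the two sides are the traces of identities of size m and n.
  This yields the equality of dimensions demanded by \<open>equivalent_rep\<close>.\<close>

lemma smat_square_of_inverses:
  fixes S T :: "nat \<Rightarrow> nat \<Rightarrow> complex"
  assumes "\<And>i j. i \<in> {1..m} \<Longrightarrow> j \<in> {1..m} \<Longrightarrow> (\<Sum>l=1..n. S i l * T l j) = (if i = j then 1 else 0)"
    and "\<And>i j. i \<in> {1..n} \<Longrightarrow> j \<in> {1..n} \<Longrightarrow> (\<Sum>l=1..m. T i l * S l j) = (if i = j then 1 else 0)"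
  shows "m = n"
proof -
  have "of_nat m = (\<Sum>i=1..m. \<Sum>l=1..n. S i l * T l i)" using assms(1) by simp
  also have "\<dots> = (\<Sum>l=1..n. \<Sum>i=1..m. T l i * S i l)"
    by (subst sum.swap) (simp add: mult.commute)
  also have "\<dots> = of_nat n" using assms(2) by simp
  finally show ?thesis using of_nat_eq_iff[where 'a=complex] by blast
qed

text \<open>The kernel and the range of S are invariant subspaces; a nonzero entry rules out full
  kernel and zero range, so S is bijective. The hypothesis names an entry because only entries
  inside the index ranges carry meaning.\<close>

lemma schur_nonzero_intertwiner:
  assumes irr1: "irreducible_rep n1 G \<rho>1" and irr2: "irreducible_rep n2 G \<rho>2"
    and comm: "\<And>g i j. g \<in> G \<Longrightarrow> i \<in> {1..n2} \<Longrightarrow> j \<in> {1..n1} \<Longrightarrow>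
      (\<Sum>l=1..n1. S i l * \<rho>1 g l j) = (\<Sum>l=1..n2. \<rho>2 g i l * S l j)"
    and nz: "i0 \<in> {1..n2}" "j0 \<in> {1..n1}" "S i0 j0 \<noteq> 0"
  shows "equivalent_rep n1 n2 G \<rho>1 \<rho>2"
proof -
  \<comment> \<open>The rectangular analogue of \<open>smat_vec\<close>, cut off outside the index
    range so that its values lie in \<open>cspace n2\<close>.\<close>
  define A where "A = (\<lambda>v i. if i \<in> {1..n2} then \<Sum>j=1..n1. S i j * v j else 0)"
  have A_zero: "A (\<lambda>_. 0) = (\<lambda>_. 0)" by (auto simp: A_def)
  have A_add: "A (\<lambda>i. v i + w i) = (\<lambda>i. A v i + A w i)" for v w
    by (auto simp: A_def algebra_simps sum.distrib)
  have A_scale: "A (\<lambda>i. c * v i) = (\<lambda>i. c * A v i)" for c v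
    by (auto simp: A_def algebra_simps sum_distrib_left)
  have A_in: "A v \<in> cspace n2" for v by (simp add: A_def cspace_def)
  have A_int: "A (smat_vec n1 (\<rho>1 g) w) = smat_vec n2 (\<rho>2 g) (A w)" if g: "g \<in> G" for g w
  proof
    fix i
    show "A (smat_vec n1 (\<rho>1 g) w) i = smat_vec n2 (\<rho>2 g) (A w) i"
    proof (cases "i \<in> {1..n2}")
      case True
      have "A (smat_vec n1 (\<rho>1 g) w) i = (\<Sum>l=1..n1. \<Sum>j=1..n1. S i l * \<rho>1 g l j * w j)"
        using True by (simp add: A_def smat_vec_def sum_distrib_left mult.assoc)
      also have "\<dots> = (\<Sum>j=1..n1. (\<Sum>l=1..n1. S i l * \<rho>1 g l j) * w j)"
        by (subst sum.swap) (simp add: sum_distrib_right)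
      also have "\<dots> = (\<Sum>j=1..n1. (\<Sum>l=1..n2. \<rho>2 g i l * S l j) * w j)"
        using comm[OF g True] by simp
      also have "\<dots> = (\<Sum>l=1..n2. \<rho>2 g i l * (\<Sum>j=1..n1. S l j * w j))"
        by (simp add: sum_distrib_right sum_distrib_left mult.assoc) (rule sum.swap)
      also have "\<dots> = smat_vec n2 (\<rho>2 g) (A w) i"
        using True by (simp add: smat_vec_def A_def)
      finally show ?thesis .
    qed (auto simp: smat_vec_def A_def)
  qed
  have A_unit: "A (\<lambda>l. if l = j then 1 else 0) i = S i j" if "i \<in> {1..n2}" "j \<in> {1..n1}" for i j
    using that by (simp add: A_def if_distrib cong: if_cong)
  define N where "N = {v \<in> cspace n1. A v = (\<lambda>_. 0)}"
  have "csubspace n1 N"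
    unfolding csubspace_def N_def
    by (auto simp: A_zero A_add A_scale) (auto simp: cspace_def)
  moreover have "smat_vec n1 (\<rho>1 g) w \<in> N" if "g \<in> G" "w \<in> N" for g w
    using that A_int[OF that(1), of w] smat_vec_in_cspace[of n1 "\<rho>1 g" w]
    by (simp add: N_def) (auto simp: smat_vec_def)
  moreover have "N \<noteq> cspace n1"
  proof
    assume "N = cspace n1"
    moreover have "(\<lambda>l. if l = j0 then 1 else 0) \<in> cspace n1" using nz(2) by (auto simp: cspace_def)
    ultimately have "A (\<lambda>l. if l = j0 then 1 else 0) = (\<lambda>_. 0)" by (auto simp: N_def)
    then show False using A_unit[OF nz(1,2)] nz(3) by simp
  qed
  ultimately have N: "N = {\<lambda>_. 0}"
    using irr1 unfolding irreducible_rep_def by blast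
  define R where "R = A ` cspace n1"
  have "csubspace n2 R"
    unfolding csubspace_def
  proof (intro conjI ballI allI)
    show "R \<subseteq> cspace n2" using A_in by (auto simp: R_def)
    have "(\<lambda>_. 0) \<in> cspace n1" by (simp add: cspace_def)
    then show "(\<lambda>_. 0) \<in> R" unfolding R_def using A_zero by (metis image_eqI)
  next
    fix v w assume "v \<in> R" "w \<in> R"
    then obtain v' w' where "v' \<in> cspace n1" "w' \<in> cspace n1" "v = A v'" "w = A w'"
      by (auto simp: R_def)
    then show "(\<lambda>i. v i + w i) \<in> R"
      unfolding R_def by (intro image_eqI[where x="\<lambda>i. v' i + w' i"]) (auto simp: A_add cspace_def)
  next
    fix c v assume "v \<in> R"
    then obtain v' where "v' \<in> cspace n1" "v = A v'" by (auto simp: R_def)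
    then show "(\<lambda>i. c * v i) \<in> R"
      unfolding R_def by (intro image_eqI[where x="\<lambda>i. c * v' i"]) (auto simp: A_scale cspace_def)
  qed
  moreover have "smat_vec n2 (\<rho>2 g) w \<in> R" if "g \<in> G" "w \<in> R" for g w
    using that A_int[OF that(1)] smat_vec_in_cspace by (auto simp: R_def simp flip: A_int)
  moreover have "R \<noteq> {\<lambda>_. 0}"
  proof
    assume R: "R = {\<lambda>_. 0}"
    have "(\<lambda>l. if l = j0 then 1 else 0) \<in> cspace n1" using nz(2) by (auto simp: cspace_def)
    then have "A (\<lambda>l. if l = j0 then 1 else 0) \<in> R" unfolding R_def by (rule imageI)
    then have "A (\<lambda>l. if l = j0 then 1 else 0) i0 = 0" unfolding R by simp
    then show False using A_unit[OF nz(1,2)] nz(3) by simp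
  qed
  ultimately have R: "R = cspace n2"
    using irr2 unfolding irreducible_rep_def by blast
  have "\<forall>j\<in>{1..n2}. \<exists>v. v \<in> cspace n1 \<and> A v = (\<lambda>l. if l = j then 1 else 0)"
  proof
    fix j assume "j \<in> {1..n2}"
    then have "(\<lambda>l. if l = j then 1 else 0) \<in> R" unfolding R by (auto simp: cspace_def)
    then show "\<exists>v. v \<in> cspace n1 \<and> A v = (\<lambda>l. if l = j then 1 else 0)"
      unfolding R_def by (metis (no_types, lifting) imageE)
  qed
  then obtain V where V: "\<And>j. j \<in> {1..n2} \<Longrightarrow> V j \<in> cspace n1"
      "\<And>j. j \<in> {1..n2} \<Longrightarrow> A (V j) = (\<lambda>l. if l = j then 1 else 0)"
    by metis
  \<comment> \<open>The columns of T are chosen preimages of the unit vectors, which makes T a right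
    inverse of S.\<close>
  define T where "T = (\<lambda>i j. V j i)"
  have ST: "(\<Sum>l=1..n1. S i l * T l j) = (if i = j then 1 else 0)"
    if "i \<in> {1..n2}" "j \<in> {1..n2}" for i j
    using fun_cong[OF V(2)[OF that(2)], of i] that(1) by (simp add: A_def T_def)
  \<comment> \<open>S (T S - 1) = 0, and S is injective.\<close>
  have TS: "(\<Sum>l=1..n2. T i l * S l j) = (if i = j then 1 else 0)"
    if i: "i \<in> {1..n1}" and j: "j \<in> {1..n1}" for i j
  proof -
    define w where "w = (\<lambda>i. if i \<in> {1..n1} then (\<Sum>l=1..n2. T i l * S l j) - (if i = j then 1 else 0) else 0)"
    have "A w k = 0" for k
    proof (cases "k \<in> {1..n2}")
      case True
      have "A w k = (\<Sum>i=1..n1. S k i * (\<Sum>l=1..n2. T i l * S l j)) - (\<Sum>i=1..n1. S k i * (if i = j then 1 else 0))"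
        using True by (simp add: A_def w_def right_diff_distrib sum_subtractf)
      also have "(\<Sum>i=1..n1. S k i * (\<Sum>l=1..n2. T i l * S l j)) = (\<Sum>l=1..n2. (\<Sum>i=1..n1. S k i * T i l) * S l j)"
        by (simp add: sum_distrib_left sum_distrib_right mult.assoc) (rule sum.swap)
      also have "\<dots> = (\<Sum>l=1..n2. if l = k then S l j else 0)"
        using ST[OF True] by (intro sum.cong) auto
      finally show ?thesis using True j by (simp add: if_distrib cong: if_cong)
    qed (auto simp: A_def)
    then have "w \<in> N" by (auto simp: N_def w_def cspace_def)
    then have "w i = 0" unfolding N by simp
    then show ?thesis using i by (simp add: w_def)
  qed
  have "n2 = n1" using ST TS by (rule smat_square_of_inverses)
  then show ?thesis
    unfolding equivalent_rep_def smat_eq_def smat_mul_def smat_id_def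
    using ST TS comm by (intro conjI exI[of _ S] exI[of _ T]) auto
qed

section \<open>Tensor powers of unitaries span those of invertible matrices\<close>

text \<open>The linear functional with coefficients B, evaluated at a tensor power. As a function of
  X it is a homogeneous polynomial of degree t in the entries, which opens the way to root
  counting.\<close>

definition tform :: "nat \<Rightarrow> ('d::finite) top \<Rightarrow> complex^'d^'d \<Rightarrow> complex" where
  "tform t B X = (\<Sum>i\<in>tidx t. \<Sum>j\<in>tidx t. B i j * tpow t X i j)"

text \<open>By duality, this says that the tensor power of \<open>X\<close> lies in the linear span of the tensor
  powers of the unitaries.\<close>

definition in_unitary_span :: "nat \<Rightarrow> complex^'d^'d \<Rightarrow> bool" where
  "in_unitary_span t X \<longleftrightarrow>
     (\<forall>B :: ('d::finite) top. (\<forall>U\<in>Uset. tform t B U = 0) \<longrightarrow> tform t B X = 0)"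

lemma finite_tidx [simp]: "finite (tidx t)"
  by (simp add: tidx_def finite_PiE)

lemma tpow_mult:
  fixes X Y :: "complex^'d::finite^'d"
  shows "tpow t (X ** Y) = opmul t (tpow t X) (tpow t Y)"
proof (intro ext)
  fix i j :: "'d tidx"
  have "tpow t (X ** Y) i j = (\<Prod>s<t. \<Sum>l\<in>UNIV. X $ i s $ l * Y $ l $ j s)"
    by (simp add: tpow_def matrix_matrix_mult_def)
  also have "\<dots> = (\<Sum>l\<in>tidx t. \<Prod>s<t. X $ i s $ l s * Y $ l s $ j s)"
    unfolding tidx_def by (subst prod_sum_PiE) simp_all
  also have "\<dots> = opmul t (tpow t X) (tpow t Y) i j"
    by (simp add: opmul_def tpow_def prod.distrib)
  finally show "tpow t (X ** Y) i j = opmul t (tpow t X) (tpow t Y) i j" .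
qed

text \<open>With one factor of the product frozen into the coefficients, what remains is a
  functional of the same kind in the other factor.\<close>

lemma tform_mult_left:
  "tform t B (X ** Y) = tform t (\<lambda>i l. \<Sum>j\<in>tidx t. B i j * tpow t Y l j) X"
proof -
  have "tform t B (X ** Y)
      = (\<Sum>i\<in>tidx t. \<Sum>j\<in>tidx t. \<Sum>l\<in>tidx t. B i j * tpow t Y l j * tpow t X i l)"
    by (simp add: tform_def tpow_mult opmul_def sum_distrib_left mult_ac)
  also have "\<dots> = (\<Sum>i\<in>tidx t. \<Sum>l\<in>tidx t. \<Sum>j\<in>tidx t. B i j * tpow t Y l j * tpow t X i l)"
    by (intro sum.cong refl sum.swap)
  finally show ?thesis by (simp add: tform_def sum_distrib_right)
qed

lemma tform_mult_right:
  "tform t B (X ** Y) = tform t (\<lambda>l j. \<Sum>i\<in>tidx t. B i j * tpow t X i l) Y"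
proof -
  have "tform t B (X ** Y)
      = (\<Sum>i\<in>tidx t. \<Sum>l\<in>tidx t. \<Sum>j\<in>tidx t. B i j * tpow t X i l * tpow t Y l j)"
    unfolding tform_def tpow_mult opmul_def
    by (subst (2) sum.swap) (simp add: sum_distrib_left mult_ac)
  also have "\<dots> = (\<Sum>l\<in>tidx t. \<Sum>i\<in>tidx t. \<Sum>j\<in>tidx t. B i j * tpow t X i l * tpow t Y l j)"
    by (rule sum.swap)
  also have "\<dots> = (\<Sum>l\<in>tidx t. \<Sum>j\<in>tidx t. \<Sum>i\<in>tidx t. B i j * tpow t X i l * tpow t Y l j)"
    by (intro sum.cong refl sum.swap)
  finally show ?thesis by (simp add: tform_def sum_distrib_right)
qed

lemma adjm_mult: "adjm (X ** Y) = adjm Y ** adjm X"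
  by (simp add: adjm_def matrix_matrix_mult_def vec_eq_iff mult.commute)

lemma Uset_mult: "U \<in> Uset \<Longrightarrow> V \<in> Uset \<Longrightarrow> U ** V \<in> Uset"
proof -
  assume "U \<in> Uset" "V \<in> Uset"
  then show ?thesis
    by (simp add: Uset_def adjm_mult) (metis matrix_mul_assoc matrix_mul_rid)
qed

text \<open>One factor at a time: the functional vanishes at V U for unitary V and U, hence at X U
  because X is in the span, hence at X Y because Y is.\<close>

lemma in_unitary_span_mult:
  fixes X Y :: "complex^'d::finite^'d"
  assumes X: "in_unitary_span t X" and Y: "in_unitary_span t Y"
  shows "in_unitary_span t (X ** Y)"
  unfolding in_unitary_span_def
proof (intro allI impI)
  fix B :: "'d top" assume B: "\<forall>U\<in>Uset. tform t B U = 0"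
  have "tform t B (X ** U) = 0" if "U \<in> Uset" for U
  proof -
    have "tform t (\<lambda>i l. \<Sum>j\<in>tidx t. B i j * tpow t U l j) V = 0" if "V \<in> Uset" for V
      using B Uset_mult[OF that \<open>U \<in> Uset\<close>] by (simp flip: tform_mult_left)
    then show ?thesis
      using X unfolding in_unitary_span_def tform_mult_left by blast
  qed
  then show "tform t B (X ** Y) = 0"
    using Y unfolding tform_mult_right in_unitary_span_def by blast
qed

section \<open>Polynomial continuation and rank-one perturbations of the identity\<close>

lemma tform_quadratic_poly:
  "\<exists>p. \<forall>z. tform t B (\<chi> i j. P i j + z * Q i j + z\<^sup>2 * R i j) = poly p z"
  by (rule exI[of _ "\<Sum>i\<in>tidx t. \<Sum>j\<in>tidx t. Polynomial.smult (B i j)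
        (\<Prod>s<t. [:P (i s) (j s), Q (i s) (j s), R (i s) (j s):])"])
     (simp add: tform_def tpow_def poly_sum poly_prod power2_eq_square algebra_simps)

text \<open>An algebraic form of analytic continuation: a polynomial with infinitely many roots is
  zero, so membership for z in S extends to every z. Degree two is what the polarisation of a
  rank-one projector produces.\<close>

lemma in_unitary_span_quadratic:
  fixes P Q R :: "'d::finite \<Rightarrow> 'd \<Rightarrow> complex"
  assumes "infinite S"
    and "\<And>z. z \<in> S \<Longrightarrow> in_unitary_span t (\<chi> i j. P i j + z * Q i j + z\<^sup>2 * R i j)"
  shows "in_unitary_span t (\<chi> i j. P i j + z * Q i j + z\<^sup>2 * R i j)"
  unfolding in_unitary_span_def
proof (intro allI impI)
  fix B :: "'d top" assume B: "\<forall>U\<in>Uset. tform t B U = 0"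
  obtain p where p: "\<And>z. tform t B (\<chi> i j. P i j + z * Q i j + z\<^sup>2 * R i j) = poly p z"
    using tform_quadratic_poly[of t B P Q R] by blast
  have "S \<subseteq> {z. poly p z = 0}"
    using B assms(2) by (auto simp: in_unitary_span_def simp flip: p)
  then have "p = 0"
    using assms(1) poly_roots_finite finite_subset by blast
  then show "tform t B (\<chi> i j. P i j + z * Q i j + z\<^sup>2 * R i j) = 0"
    by (simp add: p)
qed

lemma infinite_unit_circle: "infinite {z::complex. cmod z = 1}"
proof
  assume "finite {z::complex. cmod z = 1}"
  then have "finite (Re ` {z::complex. cmod z = 1})" by (rule finite_imageI)
  moreover have "{0..1::real} \<subseteq> Re ` {z::complex. cmod z = 1}"
  proof
    fix x :: real assume "x \<in> {0..1}"
    then have "x\<^sup>2 \<le> 1" by (simp add: power_le_one)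
    then have "cmod (Complex x (sqrt (1 - x\<^sup>2))) = 1" by (simp add: cmod_def)
    then show "x \<in> Re ` {z::complex. cmod z = 1}"
      by (intro image_eqI[where x="Complex x (sqrt (1 - x\<^sup>2))"]) simp_all
  qed
  ultimately have "finite {0..1::real}" by (rule rev_finite_subset)
  then show False using infinite_Icc[of "0::real" 1] by simp
qed

lemma sum_of_bool_mult:
  fixes f :: "'a \<Rightarrow> 'b::semiring_1"
  assumes "finite A" "i \<in> A"
  shows "(\<Sum>l\<in>A. of_bool (i = l) * f l) = f i"
proof -
  have "(\<Sum>l\<in>A. of_bool (i = l) * f l) = (\<Sum>l\<in>A. if i = l then f l else 0)"
    by (intro sum.cong) auto
  then show ?thesis using assms by simp
qed

text \<open>1 + c v v^dagger is unitary for a whole circle of values c; since the family is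
  polynomial in c, it continues to every complex c. If v = 0, the matrix is the identity.\<close>

lemma in_unitary_span_hermitian_rank_one:
  fixes v :: "complex^'d::finite"
  shows "in_unitary_span t (\<chi> i j. of_bool (i = j) + c * (v $ i * cnj (v $ j)))"
proof -
  define N where "N = (\<Sum>l\<in>UNIV. (cmod (v $ l))\<^sup>2)"
  have NC: "(\<Sum>l\<in>UNIV. v $ l * cnj (v $ l)) = of_real N"
    by (simp only: N_def of_real_sum complex_norm_square)
  let ?X = "\<lambda>c. (\<chi> i j. of_bool (i = j) + c * (v $ i * cnj (v $ j))) :: complex^'d^'d"
  have unitary: "?X c \<in> Uset" if c: "c + cnj c + c * cnj c * of_real N = 0" for c
  proof -
    have "(\<Sum>l\<in>UNIV. ?X c $ i $ l * cnj (?X c $ j $ l)) = of_bool (i = j)" for i j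
    proof -
      have "(\<Sum>l\<in>UNIV. ?X c $ i $ l * cnj (?X c $ j $ l))
          = (\<Sum>l\<in>UNIV. of_bool (i = l) * of_bool (j = l)
             + of_bool (j = l) * (c * (v $ i * cnj (v $ l)))
             + of_bool (i = l) * (cnj c * (v $ l * cnj (v $ j)))
             + c * cnj c * (v $ i * cnj (v $ j)) * (v $ l * cnj (v $ l)))"
        by (intro sum.cong refl) (simp add: algebra_simps)
      also have "\<dots> = of_bool (i = j) + (c + cnj c + c * cnj c * of_real N) * (v $ i * cnj (v $ j))"
        by (simp only: sum.distrib sum_distrib_left[symmetric] NC sum_of_bool_mult finite UNIV_I)
           (simp add: algebra_simps eq_commute)
      finally show ?thesis using c by simp
    qed
    then show ?thesis
      by (simp add: Uset_def adjm_def matrix_matrix_mult_def vec_eq_iff mat_def of_bool_def)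
  qed
  have span: "in_unitary_span t (?X c)" if "c + cnj c + c * cnj c * of_real N = 0" for c
    using unitary[OF that] unfolding in_unitary_span_def by blast
  show ?thesis
  proof (cases "N = 0")
    case True
    then have "v $ i = 0" for i by (simp add: N_def sum_nonneg_eq_0_iff)
    then show ?thesis using span[of 0] by simp
  next
    case False
    \<comment> \<open>The unitarity condition on c says exactly that w = 1 + c N has modulus 1,
      since |w|^2 = 1 + N (c + cnj c + c cnj c N).\<close>
    define S where "S = (\<lambda>w. (w - 1) / of_real N) ` {w. cmod w = 1}"
    have "infinite S"
      unfolding S_def using infinite_unit_circle False
      by (subst finite_image_iff) (auto simp: inj_on_def)
    moreover have "in_unitary_span t (?X z)" if "z \<in> S" for z
    proof -
      obtain w where w: "z = (w - 1) / of_real N" "cmod w = 1" using \<open>z \<in> S\<close> unfolding S_def by (elim imageE CollectE)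
      then have "w * cnj w = 1" using complex_norm_square[of w] by simp
      then have "z + cnj z + z * cnj z * of_real N = 0"
        using False by (simp add: w field_simps)
      then show ?thesis by (rule span)
    qed
    ultimately show ?thesis
      using in_unitary_span_quadratic[of S t "\<lambda>i j. of_bool (i = j)" "\<lambda>i j. v $ i * cnj (v $ j)" "\<lambda>_ _. 0"]
      by simp
  qed
qed

lemma infinite_complex_Reals: "infinite (range complex_of_real)"
proof
  assume "finite (range complex_of_real)"
  then have "finite (UNIV :: real set)" by (rule finite_imageD) (simp add: inj_on_def)
  then show False using infinite_UNIV_char_0 by blast
qed

lemma in_unitary_span_rank_one:
  fixes a b :: "complex^'d::finite"
  shows "in_unitary_span t (\<chi> i j. of_bool (i = j) + a $ i * b $ j)"
proof -
  \<comment> \<open>v and w solve v + i w = a and cnj v + i cnj w = b, so the continued projector at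
    x = i is a b^T.\<close>
  define v where "v = (\<chi> i. (a $ i + cnj (b $ i)) / 2)"
  define w where "w = (\<chi> i. (a $ i - cnj (b $ i)) / (2 * \<i>))"
  define P where "P = (\<lambda>i j. of_bool (i = j) + v $ i * cnj (v $ j))"
  define Q where "Q = (\<lambda>i j. v $ i * cnj (w $ j) + w $ i * cnj (v $ j))"
  define R where "R = (\<lambda>i j. w $ i * cnj (w $ j))"
  \<comment> \<open>Polarisation: the Hermitian projectors on v + x w, x real, continued to x = i.\<close>
  have "in_unitary_span t (\<chi> i j. P i j + z * Q i j + z\<^sup>2 * R i j)"
    if "z \<in> range of_real" for z
  proof -
    obtain x where x: "z = of_real x" using \<open>z \<in> range of_real\<close> by (elim rangeE)
    have "(\<chi> i j. P i j + z * Q i j + z\<^sup>2 * R i j) =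
        (\<chi> i j. of_bool (i = j) + 1 * ((v + z *s w) $ i * cnj ((v + z *s w) $ j)))"
      by (simp add: vec_eq_iff P_def Q_def R_def x power2_eq_square algebra_simps)
    then show ?thesis
      using in_unitary_span_hermitian_rank_one[of t 1 "v + z *s w"] by simp
  qed
  then have "in_unitary_span t (\<chi> i j. P i j + \<i> * Q i j + \<i>\<^sup>2 * R i j)"
    by (rule in_unitary_span_quadratic[OF infinite_complex_Reals])
  moreover have "(\<chi> i j. P i j + \<i> * Q i j + \<i>\<^sup>2 * R i j) = (\<chi> i j. of_bool (i = j) + a $ i * b $ j)"
    by (simp add: vec_eq_iff P_def Q_def R_def v_def w_def power2_eq_square field_simps)
  ultimately show ?thesis by simp
qed

section \<open>Elementary matrices: from rank-one perturbations to all invertible matrices\<close>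

definition cmat :: "real^'d^'d \<Rightarrow> complex^'d^'d" where
  "cmat A = (\<chi> i j. of_real (A $ i $ j))"

lemma cmat_mult: "cmat (A ** B) = cmat A ** cmat B"
  by (simp add: cmat_def matrix_matrix_mult_def vec_eq_iff)

text \<open>A diagonal matrix is a product of matrices 1 + (d_k - 1) e_k e_k^T. The induction runs
  over the set F of entries already set, the others being 1.\<close>

lemma in_unitary_span_diagonal:
  "in_unitary_span t (\<chi> i j. if i = j then d i else 0 :: complex^'d::finite^'d)"
proof -
  have "in_unitary_span t (\<chi> i j. if i = j then (if i \<in> F then d i else 1) else 0 :: complex^'d^'d)"
    if "finite F" for F
    using that
  proof induction
    case empty
    show ?case
      using in_unitary_span_rank_one[of t "0 :: complex^'d" 0] by (simp add: of_bool_def cong: if_cong)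
  next
    case (insert k F)
    let ?E = "(\<chi> i j. of_bool (i = j) + ((d k - 1) *s axis k 1) $ i * axis k 1 $ j) :: complex^'d^'d"
    let ?D = "\<lambda>F. (\<chi> i j. if i = j then (if i \<in> F then d i else 1) else 0) :: complex^'d^'d"
    have "?E ** ?D F = ?D (insert k F)"
    proof -
      have "(?E ** ?D F) $ i $ j = ?D (insert k F) $ i $ j" for i j
      proof -
        have "(?E ** ?D F) $ i $ j
            = (\<Sum>l\<in>UNIV. of_bool (j = l) * (?E $ i $ l * (if l \<in> F then d l else 1)))"
          unfolding matrix_matrix_mult_def vec_lambda_beta by (intro sum.cong refl) auto
        also have "\<dots> = ?E $ i $ j * (if j \<in> F then d j else 1)"
          by (rule sum_of_bool_mult) auto
        also have "\<dots> = ?D (insert k F) $ i $ j"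
          using insert.hyps by (auto simp: axis_def)
        finally show ?thesis .
      qed
      then show ?thesis by (simp add: vec_eq_iff)
    qed
    then show ?case
      using in_unitary_span_mult[OF in_unitary_span_rank_one[of t "(d k - 1) *s axis k 1" "axis k 1"] insert.IH]
      by (simp only:)
  qed
  from this[of UNIV] show ?thesis by (simp cong: if_cong)
qed

text \<open>The generators are diagonal or of the form 1 + a b^T: a transposition is 1 - (e_m -
  e_n)(e_m - e_n)^T, a row addition is 1 + c e_m e_n^T. The determinant passes to both factors of a
  product and excludes a zero row.\<close>

lemma in_unitary_span_real:
  "det A \<noteq> 0 \<longrightarrow> in_unitary_span t (cmat (A :: real^'d::finite^'d))"
proof (induction A rule: induct_matrix_elementary)
  case (1 A B)
  then show ?case by (auto simp: det_mul cmat_mult intro: in_unitary_span_mult)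
next
  case (2 A i)
  then show ?case by (simp add: det_zero_row)
next
  case (3 A)
  then have eq: "cmat A = (\<chi> i j. if i = j then of_real (A $ i $ i) else 0)"
    by (auto simp: cmat_def vec_eq_iff)
  show ?case unfolding eq by (intro impI in_unitary_span_diagonal)
next
  case (4 m n)
  have eq: "cmat (\<chi> i j. mat 1 $ i $ Transposition.transpose m n j) =
     (\<chi> i j. of_bool (i = j) + (axis m 1 - axis n 1) $ i * (axis n 1 - axis m 1) $ j)"
    using 4 by (auto simp: cmat_def vec_eq_iff mat_def axis_def Transposition.transpose_def)
  show ?case unfolding eq by (intro impI in_unitary_span_rank_one)
next
  case (5 m n c)
  have eq: "cmat (\<chi> i j. if i = m \<and> j = n then c else of_bool (i = j)) =
     (\<chi> i j. of_bool (i = j) + (of_real c *s axis m 1) $ i * (axis n 1) $ j)"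
    using 5 by (auto simp: cmat_def vec_eq_iff axis_def)
  show ?case unfolding eq by (intro impI in_unitary_span_rank_one)
qed

text \<open>Write X = A + i B with A, B real. The determinant of A + z B is a polynomial in z that
  is nonzero at z = i, so A + z B is invertible for all but finitely many real z; these infinitely
  many real cases continue to z = i.\<close>

lemma in_unitary_span_GL:
  fixes X :: "complex^'d::finite^'d"
  assumes "X \<in> GLset"
  shows "in_unitary_span t X"
proof -
  define A where "A = (\<lambda>i j. Re (X $ i $ j))"
  define B where "B = (\<lambda>i j. Im (X $ i $ j))"
  \<comment> \<open>The zero quadratic term gives this linear family the shape expected by
    \<open>in_unitary_span_quadratic\<close>.\<close>
  let ?Z = "\<lambda>z. (\<chi> i j. of_real (A i j) + z * of_real (B i j) + z\<^sup>2 * 0) :: complex^'d^'d"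
  define p where "p = (\<Sum>p | p permutes (UNIV::'d set).
     Polynomial.smult (of_int (sign p)) (\<Prod>i\<in>UNIV. [:complex_of_real (A i (p i)), of_real (B i (p i)):]))"
  have p: "det (?Z z) = poly p z" for z
    by (simp add: det_def p_def poly_sum poly_prod)
  have X: "?Z \<i> = X"
    by (simp add: vec_eq_iff A_def B_def complex_eq_iff)
  then have "poly p \<i> \<noteq> 0" using assms by (simp add: GLset_def flip: p)
  then have "finite {z. poly p z = 0}" by (intro poly_roots_finite) auto
  then have inf: "infinite (range complex_of_real - {z. poly p z = 0})"
    using infinite_complex_Reals by simp
  have "in_unitary_span t (?Z z)" if z: "z \<in> range complex_of_real - {z. poly p z = 0}" for z
  proof -
    obtain x where x: "z = of_real x" using z by (elim DiffE rangeE)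
    define C :: "real^'d^'d" where "C = (\<chi> i j. A i j + x * B i j)"
    have C: "?Z z = cmat C" by (simp add: C_def cmat_def vec_eq_iff x)
    have "det (cmat C) = of_real (det C)" by (simp add: det_def cmat_def)
    then have "det C \<noteq> 0" using z p[of z] C by auto
    then show ?thesis unfolding C using in_unitary_span_real by blast
  qed
  then have "in_unitary_span t (?Z \<i>)" by (rule in_unitary_span_quadratic[OF inf])
  then show ?thesis by (simp only: X)
qed

lemma tpow_scale: "tpow t (\<chi> i j. c * X $ i $ j) i j = c ^ t * tpow t X i j"
  by (simp add: tpow_def prod.distrib)

text \<open>The determinant of U has modulus 1; take c to be a d-th root of it, again of modulus 1,
  and divide it out.\<close>

lemma unitary_eq_phase_SU:
  fixes U :: "complex^'d::finite^'d"
  assumes "U \<in> Uset"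
  shows "\<exists>c K. K \<in> SUset \<and> U = (\<chi> i j. c * K $ i $ j)"
proof -
  have U: "U ** adjm U = mat 1" using assms by (simp add: Uset_def)
  have "det (adjm U) = cnj (det U)"
  proof -
    have "det (adjm U) = det (transpose (adjm U))" by simp
    also have "transpose (adjm U) = (\<chi> i j. cnj (U $ i $ j))"
      by (simp add: adjm_def Finite_Cartesian_Product.transpose_def)
    also have "det \<dots> = cnj (det U)" by (simp add: det_def)
    finally show ?thesis .
  qed
  then have "det U * cnj (det U) = 1" using arg_cong[OF U, of det] by (simp add: det_mul)
  then have n1: "cmod (det U) = 1"
    by (metis abs_norm_cancel complex_mod_cnj norm_mult norm_one power2_eq_square real_sqrt_abs real_sqrt_one)
  define c where "c = cis (Arg (det U) / CARD('d))"
  have c: "c ^ CARD('d) = det U"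
  proof -
    have "c ^ CARD('d) = cis (real CARD('d) * (Arg (det U) / CARD('d)))"
      unfolding c_def by (rule Complex.DeMoivre)
    also have "\<dots> = det U" using n1 rcis_cmod_Arg[of "det U"] by (simp add: rcis_def)
    finally show ?thesis .
  qed
  have cc: "c * cnj c = 1" by (simp add: c_def cis_cnj cis_mult)
  \<comment> \<open>Since c has modulus 1, \<open>cnj c\<close> is its inverse.\<close>
  define K where "K = (\<chi> i j. cnj c * U $ i $ j)"
  have "det K = cnj c ^ CARD('d) * det U"
    unfolding K_def det_def by (simp add: prod.distrib sum_distrib_left mult_ac)
  also have "\<dots> = (c * cnj c) ^ CARD('d)" by (simp only: c[symmetric] power_mult_distrib mult.commute)
  finally have "det K = 1" by (simp only: cc power_one)
  moreover have "K ** adjm K = U ** adjm U"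
  proof -
    have "K $ i $ l * adjm K $ l $ j = (c * cnj c) * (U $ i $ l * adjm U $ l $ j)" for i j l
      by (simp add: K_def adjm_def)
    then show ?thesis unfolding matrix_matrix_mult_def cc by simp
  qed
  ultimately have "K \<in> SUset" using U by (simp add: SUset_def)
  moreover have "U = (\<chi> i j. c * K $ i $ j)"
  proof -
    have "c * K $ i $ j = (c * cnj c) * U $ i $ j" for i j by (simp add: K_def)
    then show ?thesis unfolding cc by (simp add: vec_eq_iff)
  qed
  ultimately show ?thesis by blast
qed

text \<open>For fixed i and j, the commutator entry is a linear functional of the tensor power, so
  the span result applies. Passing from SU(d) to U(d) costs only a factor c^t, which does not affect
  vanishing.\<close>

lemma commute_SU_imp_commute_GL:
  fixes X :: "complex^'d::finite^'d"
  assumes SU: "\<And>K i j. K \<in> SUset \<Longrightarrow> i \<in> tidx t \<Longrightarrow> j \<in> tidx t \<Longrightarrow>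
       opmul t C (tpow t K) i j = opmul t (tpow t K) C i j"
    and X: "X \<in> GLset" and i: "i \<in> tidx t" and j: "j \<in> tidx t"
  shows "opmul t C (tpow t X) i j = opmul t (tpow t X) C i j"
proof -
  \<comment> \<open>Coefficients of entry (i, j) of C Y - Y C as a functional of Y.\<close>
  define B where "B = (\<lambda>a b. C i a * of_bool (b = j) - of_bool (a = i) * C b j)"
  have B: "tform t B X = opmul t C (tpow t X) i j - opmul t (tpow t X) C i j" for X
  proof -
    have "tform t B X = (\<Sum>a\<in>tidx t. \<Sum>b\<in>tidx t. of_bool (j = b) * (C i a * tpow t X a b))
        - (\<Sum>a\<in>tidx t. of_bool (i = a) * (\<Sum>b\<in>tidx t. C b j * tpow t X a b))"
      unfolding tform_def B_def sum_distrib_left sum_subtractf[symmetric]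
      by (intro sum.cong refl) (simp add: algebra_simps eq_commute)
    then show ?thesis
      using i j by (simp add: sum_of_bool_mult opmul_def mult.commute)
  qed
  have "tform t B U = 0" if "U \<in> Uset" for U
  proof -
    obtain c K where K: "K \<in> SUset" "U = (\<chi> i j. c * K $ i $ j)"
      using unitary_eq_phase_SU[OF \<open>U \<in> Uset\<close>] by blast
    have "tform t B U = c ^ t * tform t B K"
      by (simp add: K(2) tform_def tpow_scale sum_distrib_left mult_ac)
    then show ?thesis using SU[OF K(1) i j] by (simp add: B)
  qed
  then have "tform t B X = 0"
    using in_unitary_span_GL[OF X, of t] by (simp add: in_unitary_span_def)
  then show ?thesis by (simp add: B)
qed

section \<open>Twirling maps\<close>

lemma norm_entry_le_onorm:
  fixes A :: "complex^'n^'m"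
  shows "norm (A $ i $ j) \<le> onorm ((*v) A)"
proof -
  have "A $ i $ j = (A *v axis j 1) $ i"
    by (simp add: matrix_vector_mult_def axis_def mult_delta_right)
  then have "norm (A $ i $ j) \<le> norm (A *v axis j 1)"
    by (metis Finite_Cartesian_Product.norm_nth_le)
  also have "\<dots> \<le> onorm ((*v) A) * norm (axis j (1::complex))"
    by (rule onorm) (rule matrix_vector_mul_bounded_linear)
  finally show ?thesis by (simp add: norm_axis_1)
qed

lemma onorm_le_entries:
  fixes A :: "complex^'n^'m"
  shows "onorm ((*v) A) \<le> (\<Sum>i\<in>UNIV. \<Sum>j\<in>UNIV. norm (A $ i $ j))"
proof (rule onorm_bound)
  fix x :: "complex^'n"
  have "norm (A *v x) \<le> (\<Sum>i\<in>UNIV. norm ((A *v x) $ i))"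
    unfolding norm_vec_def by (rule L2_set_le_sum) simp
  also have "\<dots> \<le> (\<Sum>i\<in>UNIV. \<Sum>j\<in>UNIV. norm (A $ i $ j) * norm x)"
    unfolding matrix_vector_mult_def vec_lambda_beta
    by (intro sum_mono order_trans[OF norm_sum]) (simp only: norm_mult mult_left_mono Finite_Cartesian_Product.norm_nth_le norm_ge_zero)
  finally show "norm (A *v x) \<le> (\<Sum>i\<in>UNIV. \<Sum>j\<in>UNIV. norm (A $ i $ j)) * norm x"
    by (simp add: sum_distrib_right)
qed (simp add: sum_nonneg)

lemma onorm_matrix_le_add:
  fixes A B :: "complex^'n^'m"
  shows "onorm ((*v) A) \<le> onorm ((*v) B) + onorm ((*v) (A - B))"
proof -
  have "(*v) A = (\<lambda>x. B *v x + (A - B) *v x)"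
    by (simp add: fun_eq_iff flip: matrix_vector_mult_add_rdistrib)
  then show ?thesis
    using onorm_triangle[OF matrix_vector_mul_bounded_linear[of B] matrix_vector_mul_bounded_linear[of "A - B"]]
    by simp
qed

text \<open>By the triangle inequality the norms of A and B differ by at most the norm of A - B,
  which the sum of the absolute values of its entries dominates.\<close>

lemma continuous_on_onorm_matrix:
  "continuous_on UNIV (\<lambda>A::complex^'n^'m. onorm ((*v) A))"
proof -
  have "isCont (\<lambda>A::complex^'n^'m. onorm ((*v) A)) B" for B
    unfolding isCont_def
  proof (rule LIM_zero_cancel, rule Lim_null_comparison)
    show "eventually (\<lambda>A. norm (onorm ((*v) A) - onorm ((*v) B))
        \<le> (\<Sum>i\<in>UNIV. \<Sum>j\<in>UNIV. norm ((A - B) $ i $ j))) (at B)"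
    proof (rule always_eventually, rule allI)
      fix A :: "complex^'n^'m"
      have "onorm ((*v) (B - A)) \<le> (\<Sum>i\<in>UNIV. \<Sum>j\<in>UNIV. norm ((A - B) $ i $ j))"
        using onorm_le_entries[of "B - A"] by (simp add: norm_minus_commute)
      then show "norm (onorm ((*v) A) - onorm ((*v) B)) \<le> (\<Sum>i\<in>UNIV. \<Sum>j\<in>UNIV. norm ((A - B) $ i $ j))"
        using onorm_matrix_le_add[of A B] onorm_matrix_le_add[of B A] onorm_le_entries[of "A - B"]
        by (simp add: abs_le_iff)
    qed
    have "((\<lambda>A::complex^'n^'m. \<Sum>i\<in>UNIV. \<Sum>j\<in>UNIV. norm ((A - B) $ i $ j))
        \<longlongrightarrow> (\<Sum>i\<in>UNIV. \<Sum>j\<in>UNIV. norm ((B - B) $ i $ j))) (at B)"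
      by (intro tendsto_intros)
    then show "((\<lambda>A::complex^'n^'m. \<Sum>i\<in>UNIV. \<Sum>j\<in>UNIV. norm ((A - B) $ i $ j)) \<longlongrightarrow> 0) (at B)"
      by simp
  qed
  then show ?thesis by (simp add: continuous_at_imp_continuous_on)
qed

lemma borel_measurable_matrix_entry:
  "(\<lambda>A::complex^'n^'m. A $ i $ j) \<in> borel_measurable borel"
  by (intro borel_measurable_continuous_onI continuous_intros)

lemma normA_nth: "normA A $ i $ j = A $ i $ j /\<^sub>R onorm ((*v) A)"
  by (simp add: normA_def divide_inverse)

lemma borel_measurable_normA_entry:
  "(\<lambda>A::complex^'n^'n. normA A $ i $ j) \<in> borel_measurable borel"
  unfolding normA_nth
  by (intro borel_measurable_scaleR borel_measurable_inverse borel_measurable_matrix_entry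
      borel_measurable_continuous_onI[OF continuous_on_onorm_matrix])

text \<open>True for every matrix: if the norm is 0, division by zero makes \<open>normA A\<close>
  zero. The bound therefore holds everywhere, not just almost everywhere.\<close>

lemma norm_normA_entry_le_1:
  fixes A :: "complex^'n^'n"
  shows "norm (normA A $ i $ j) \<le> 1"
  using norm_entry_le_onorm[of A i j] order_trans[OF norm_ge_zero norm_entry_le_onorm[of A i j]]
  by (auto simp: normA_nth divide_simps)

lemma norm_SU_entry_le_1:
  fixes K :: "complex^'n^'n"
  assumes "K \<in> SUset"
  shows "norm (K $ i $ j) \<le> 1"
proof -
  have "(K ** adjm K) $ i $ i = 1" using assms by (simp add: SUset_def mat_def)
  then have "of_real (\<Sum>l\<in>UNIV. (norm (K $ i $ l))\<^sup>2) = (1::complex)"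
    unfolding of_real_sum complex_norm_square by (simp add: matrix_matrix_mult_def adjm_def)
  then have "(\<Sum>l\<in>UNIV. (norm (K $ i $ l))\<^sup>2) = 1" using of_real_eq_1_iff by blast
  moreover have "(norm (K $ i $ j))\<^sup>2 \<le> (\<Sum>l\<in>UNIV. (norm (K $ i $ l))\<^sup>2)"
    by (rule member_le_sum) auto
  ultimately show ?thesis by (simp add: power_le_one_iff abs_square_le_1)
qed

lemma normA_diagonal:
  assumes "A \<in> Aset" "i \<noteq> j"
  shows "normA A $ i $ j = 0"
  using assms by (simp add: Aset_def normA_nth)

text \<open>Real diagonal matrices are self-adjoint; this is what later turns X X^dagger into the
  square appearing in beta.\<close>

lemma adjm_normA:
  assumes "A \<in> Aset"
  shows "adjm (normA A) = normA A"
proof -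
  have "cnj (normA A $ j $ i) = normA A $ i $ j" for i j
  proof (cases "i = j")
    case True
    have "A $ i $ i \<in> \<real>" using assms by (simp add: Aset_def)
    then show ?thesis using True by (simp add: normA_nth Reals_cnj_iff)
  next
    case False
    then show ?thesis using normA_diagonal[OF assms, of i j] normA_diagonal[OF assms, of j i] by simp
  qed
  then show ?thesis by (simp add: adjm_def vec_eq_iff)
qed

text \<open>Normalising may destroy determinant 1 but not invertibility, and the Schur basis
  describes the action of all invertible matrices.\<close>

lemma normA_in_GLset:
  fixes A :: "complex^'n::finite^'n"
  assumes A: "A \<in> Aset"
  shows "normA A \<in> GLset"
proof -
  have "normA A $ i $ i \<noteq> 0" for i
  proof -
    have "0 < Re (A $ i $ i)" using A by (simp add: Aset_def)
    then have "A $ i $ i \<noteq> 0" by auto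
    moreover from this have "onorm ((*v) A) \<noteq> 0"
      using norm_entry_le_onorm[of A i i] by auto
    ultimately show ?thesis by (simp add: normA_nth)
  qed
  then show ?thesis
    using det_diagonal[of "normA A"] normA_diagonal[OF A] by (simp add: GLset_def)
qed

lemma SUset_subset_GLset: "SUset \<subseteq> GLset"
  by (auto simp: SUset_def GLset_def)

lemma tpow_adjm: "tpow t (adjm X) = opadj (tpow t X)"
  by (simp add: fun_eq_iff tpow_def adjm_def opadj_def)

lemma tpow_mat_1:
  assumes "i \<in> tidx t" "j \<in> tidx t"
  shows "tpow t (mat 1) i j = of_bool (i = j)"
proof (cases "i = j")
  case True
  then show ?thesis by (simp add: tpow_def mat_def)
next
  case False
  have "\<exists>s<t. i s \<noteq> j s"
  proof (rule ccontr)
    assume "\<not> (\<exists>s<t. i s \<noteq> j s)"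
    then have "i = j" using assms unfolding tidx_def by (intro PiE_ext) auto
    with False show False ..
  qed
  then have "tpow t (mat 1) i j = 0" by (auto simp: tpow_def mat_def)
  then show ?thesis using False by simp
qed

lemma opmul_assoc: "opmul t (opmul t X Y) Z = opmul t X (opmul t Y Z)"
proof (intro ext)
  fix i j
  have "opmul t (opmul t X Y) Z i j = (\<Sum>l\<in>tidx t. \<Sum>k\<in>tidx t. X i k * Y k l * Z l j)"
    by (simp add: opmul_def sum_distrib_right)
  also have "\<dots> = (\<Sum>k\<in>tidx t. \<Sum>l\<in>tidx t. X i k * Y k l * Z l j)"
    by (rule sum.swap)
  finally show "opmul t (opmul t X Y) Z i j = opmul t X (opmul t Y Z) i j"
    by (simp add: opmul_def sum_distrib_left mult.assoc)
qed

definition conj_op :: "nat \<Rightarrow> complex^'d^'d \<Rightarrow> ('d::finite) top \<Rightarrow> 'd top" where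
  "conj_op t X \<rho> = opmul t (opmul t (tpow t X) \<rho>) (tpow t (adjm X))"

text \<open>Matrix of the linear map rho -> X rho X^dagger. It isolates the dependence on X, so
  averaging over X averages coefficients.\<close>

definition conj_kernel :: "nat \<Rightarrow> complex^'d^'d \<Rightarrow> ('d::finite) tidx \<Rightarrow> 'd tidx \<Rightarrow> 'd tidx \<Rightarrow> 'd tidx \<Rightarrow> complex" where
  "conj_kernel t X i j a b = tpow t X i a * cnj (tpow t X j b)"

text \<open>The family \<open>\<phi>\<close> lets one notion serve both the Haar twirl (identity
  family) and the average over A_n (\<open>normA\<close>).\<close>

definition twirl :: "nat \<Rightarrow> 'a measure \<Rightarrow> ('a \<Rightarrow> complex^'d^'d) \<Rightarrow> ('d::finite) top \<Rightarrow> 'd top" where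
  "twirl t \<mu> \<phi> \<rho> = (\<lambda>i j. \<integral>x. conj_op t (\<phi> x) \<rho> i j \<partial>\<mu>)"

lemma conj_op_kernel:
  "conj_op t X \<rho> i j = (\<Sum>a\<in>tidx t. \<Sum>b\<in>tidx t. conj_kernel t X i j a b * \<rho> a b)"
proof -
  have "conj_op t X \<rho> i j = (\<Sum>b\<in>tidx t. \<Sum>a\<in>tidx t. conj_kernel t X i j a b * \<rho> a b)"
    by (simp add: conj_op_def opmul_def conj_kernel_def tpow_adjm opadj_def sum_distrib_right
        sum_distrib_left mult_ac)
  also have "\<dots> = (\<Sum>a\<in>tidx t. \<Sum>b\<in>tidx t. conj_kernel t X i j a b * \<rho> a b)"
    by (rule sum.swap)
  finally show ?thesis .
qed

lemma conj_op_mult: "conj_op t (X ** Y) \<rho> = conj_op t X (conj_op t Y \<rho>)"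
  by (simp add: conj_op_def adjm_mult tpow_mult opmul_assoc)

text \<open>The bound is only almost sure because the Haar measure is a measure on all matrices that
  is concentrated on \<open>SUset\<close>.\<close>

definition bounded_family :: "'a measure \<Rightarrow> ('a \<Rightarrow> complex^'d^'d) \<Rightarrow> bool" where
  "bounded_family \<mu> \<phi> \<longleftrightarrow> finite_measure \<mu> \<and>
     (\<forall>i j. (\<lambda>x. \<phi> x $ i $ j) \<in> borel_measurable \<mu>) \<and> (AE x in \<mu>. \<forall>i j. norm (\<phi> x $ i $ j) \<le> 1)"

lemma norm_tpow_le_1:
  assumes "\<And>i j. norm (X $ i $ j) \<le> 1"
  shows "norm (tpow t X i j) \<le> 1"
  unfolding tpow_def prod_norm[symmetric] by (intro prod_le_1) (simp add: assms)

lemma borel_measurable_tpow: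
  assumes "bounded_family \<mu> \<phi>"
  shows "(\<lambda>x. tpow t (\<phi> x) i j) \<in> borel_measurable \<mu>"
  using assms unfolding tpow_def bounded_family_def by (intro borel_measurable_prod) auto

lemma integrable_tpow_products:
  assumes \<phi>: "bounded_family \<mu> \<phi>"
  shows "integrable \<mu> (\<lambda>x. conj_kernel t (\<phi> x) i j a b)"
    and "integrable \<mu> (\<lambda>x. tpow t (\<phi> x) i a * tpow t (\<phi> x) j b)"
proof -
  interpret finite_measure \<mu> using \<phi> by (simp add: bounded_family_def)
  have bd: "AE x in \<mu>. \<forall>i j. norm (tpow t (\<phi> x) i j) \<le> 1"
    using \<phi> unfolding bounded_family_def by (auto intro: norm_tpow_le_1)
  have "AE x in \<mu>. norm (conj_kernel t (\<phi> x) i j a b) \<le> 1"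
    using bd by eventually_elim (simp add: conj_kernel_def norm_mult mult_le_one)
  moreover have "(\<lambda>x. conj_kernel t (\<phi> x) i j a b) \<in> borel_measurable \<mu>"
    unfolding conj_kernel_def
    by (intro borel_measurable_times borel_measurable_tpow[OF \<phi>]
        measurable_compose[OF borel_measurable_tpow[OF \<phi>] borel_measurable_continuous_onI]
        continuous_intros)
  ultimately show "integrable \<mu> (\<lambda>x. conj_kernel t (\<phi> x) i j a b)"
    by (intro integrable_const_bound[where B=1])
  have "AE x in \<mu>. norm (tpow t (\<phi> x) i a * tpow t (\<phi> x) j b) \<le> 1"
    using bd by eventually_elim (simp add: norm_mult mult_le_one)
  then show "integrable \<mu> (\<lambda>x. tpow t (\<phi> x) i a * tpow t (\<phi> x) j b)"
    by (intro integrable_const_bound[where B=1] borel_measurable_times borel_measurable_tpow[OF \<phi>])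
qed

lemma integrable_conj_op:
  assumes "bounded_family \<mu> \<phi>"
  shows "integrable \<mu> (\<lambda>x. conj_op t (\<phi> x) \<rho> i j)"
  unfolding conj_op_kernel
  by (intro Bochner_Integration.integrable_sum integrable_mult_left integrable_tpow_products assms)

lemma twirl_kernel:
  assumes "bounded_family \<mu> \<phi>"
  shows "twirl t \<mu> \<phi> \<rho> i j =
    (\<Sum>a\<in>tidx t. \<Sum>b\<in>tidx t. (\<integral>x. conj_kernel t (\<phi> x) i j a b \<partial>\<mu>) * \<rho> a b)"
  unfolding twirl_def conj_op_kernel
  using integrable_tpow_products(1)[OF assms]
  by (simp add: Bochner_Integration.integral_sum)

section \<open>Fubini for the threefold integral\<close>

lemma
  fixes f g :: "_ \<Rightarrow> complex"
  assumes "sigma_finite_measure M1" "sigma_finite_measure M2"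
    and f: "integrable M1 f" and g: "integrable M2 g"
  shows integrable_pair_product: "integrable (M1 \<Otimes>\<^sub>M M2) (\<lambda>p. f (fst p) * g (snd p))"
    and integral_pair_product:
      "(\<integral>p. f (fst p) * g (snd p) \<partial>(M1 \<Otimes>\<^sub>M M2)) = (\<integral>x. f x \<partial>M1) * (\<integral>y. g y \<partial>M2)"
proof -
  interpret pair_sigma_finite M1 M2 using assms by (simp add: pair_sigma_finite_def)
  have [measurable]: "f \<in> borel_measurable M1" "g \<in> borel_measurable M2" using f g by auto
  show int: "integrable (M1 \<Otimes>\<^sub>M M2) (\<lambda>p. f (fst p) * g (snd p))"
  proof (rule Fubini_integrable)
    show "integrable M1 (\<lambda>x. \<integral>y. norm (f (fst (x, y)) * g (snd (x, y))) \<partial>M2)"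
      using f by (simp add: norm_mult)
    show "AE x in M1. integrable M2 (\<lambda>y. f (fst (x, y)) * g (snd (x, y)))"
      using g by simp
  qed measurable
  show "(\<integral>p. f (fst p) * g (snd p) \<partial>(M1 \<Otimes>\<^sub>M M2)) = (\<integral>x. f x \<partial>M1) * (\<integral>y. g y \<partial>M2)"
    using integral_fst'[OF int] by simp
qed

text \<open>The integrand is a finite sum of products of a kernel entry in x and an entry of G in y,
  so only product integrals occur. Keeping G arbitrary allows the result to be nested.\<close>

lemma
  assumes \<phi>: "bounded_family M1 \<phi>" and M2: "sigma_finite_measure M2"
    and G: "\<And>a b. integrable M2 (G a b)"
  shows integrable_pair_conj_op:
      "integrable (M1 \<Otimes>\<^sub>M M2) (\<lambda>p. conj_op t (\<phi> (fst p)) (\<lambda>a b. G a b (snd p)) i j)"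
    and integral_pair_conj_op:
      "(\<integral>p. conj_op t (\<phi> (fst p)) (\<lambda>a b. G a b (snd p)) i j \<partial>(M1 \<Otimes>\<^sub>M M2))
        = twirl t M1 \<phi> (\<lambda>a b. \<integral>y. G a b y \<partial>M2) i j"
proof -
  have M1: "sigma_finite_measure M1"
    using \<phi> by (simp add: bounded_family_def finite_measure.axioms)
  note int = integrable_pair_product[OF M1 M2 integrable_tpow_products(1)[OF \<phi>] G]
  show "integrable (M1 \<Otimes>\<^sub>M M2) (\<lambda>p. conj_op t (\<phi> (fst p)) (\<lambda>a b. G a b (snd p)) i j)"
    unfolding conj_op_kernel by (intro Bochner_Integration.integrable_sum int)
  show "(\<integral>p. conj_op t (\<phi> (fst p)) (\<lambda>a b. G a b (snd p)) i j \<partial>(M1 \<Otimes>\<^sub>M M2))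
        = twirl t M1 \<phi> (\<lambda>a b. \<integral>y. G a b y \<partial>M2) i j"
    unfolding conj_op_kernel twirl_kernel[OF \<phi>]
    by (simp add: Bochner_Integration.integral_sum int
        integral_pair_product[OF M1 M2 integrable_tpow_products(1)[OF \<phi>] G])
qed

lemma bounded_family_haar:
  assumes "haar_SU \<mu>"
  shows "bounded_family \<mu> (\<lambda>K. K)"
proof -
  interpret prob_space \<mu> using assms by (simp add: haar_SU_def)
  have s: "sets \<mu> = sets borel" and ae: "AE K in \<mu>. K \<in> SUset"
    using assms by (simp_all add: haar_SU_def)
  have "AE K in \<mu>. \<forall>i j. norm (K $ i $ j) \<le> 1"
    using ae by eventually_elim (simp add: norm_SU_entry_le_1)
  then show ?thesis
    unfolding bounded_family_def
    unfolding measurable_cong_sets[OF s refl]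
    by (intro conjI allI borel_measurable_matrix_entry finite_measure_axioms)
qed

lemma bounded_family_normA:
  assumes "prob_space \<mu>" "sets \<mu> = sets borel"
  shows "bounded_family \<mu> normA"
proof -
  interpret prob_space \<mu> by fact
  show ?thesis
    unfolding bounded_family_def
    unfolding measurable_cong_sets[OF assms(2) refl]
    by (intro conjI allI AE_I2 borel_measurable_normA_entry finite_measure_axioms norm_normA_entry_le_1)
qed

lemma TSL_eq_twirls:
  assumes H: "haar_SU muH" and A: "prob_space muA" "sets muA = sets borel"
  shows "TSL t muH muA \<rho> = twirl t muH (\<lambda>K. K) (twirl t muA normA (twirl t muH (\<lambda>K. K) \<rho>))"
proof (intro ext)
  fix i j
  note bH = bounded_family_haar[OF H] and bA = bounded_family_normA[OF A]
  interpret H: prob_space muH using H by (simp add: haar_SU_def)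
  interpret A: prob_space muA by fact
  interpret AH: pair_prob_space muA muH ..
  have "TSL t muH muA \<rho> i j =
      (\<integral>p. conj_op t (fst p) (\<lambda>a b. conj_op t (normA (fst (snd p))) (\<lambda>c d. conj_op t (snd (snd p)) \<rho> c d) a b) i j
         \<partial>(muH \<Otimes>\<^sub>M (muA \<Otimes>\<^sub>M muH)))"
    unfolding TSL_def
    by (intro Bochner_Integration.integral_cong refl)
       (simp add: case_prod_beta matrix_mul_assoc flip: conj_op_def conj_op_mult)
  \<comment> \<open>Fubini is used twice: first with (A, K') as a single variable, the conjugation
    by A_n playing the integrable inner family, then to separate A from K'.\<close>
  also have "\<dots> = twirl t muH (\<lambda>K. K) (twirl t muA normA (twirl t muH (\<lambda>K. K) \<rho>)) i j"
    by (subst integral_pair_conj_op[OF bH AH.sigma_finite_measure_axioms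
          integrable_pair_conj_op[OF bA H.sigma_finite_measure_axioms integrable_conj_op[OF bH]]])
       (simp add: integral_pair_conj_op[OF bA H.sigma_finite_measure_axioms integrable_conj_op[OF bH]]
          twirl_def[of t muH, symmetric])
  finally show "TSL t muH muA \<rho> i j =
      twirl t muH (\<lambda>K. K) (twirl t muA normA (twirl t muH (\<lambda>K. K) \<rho>)) i j" .
qed

text \<open>Left invariance replaces K by U K under the integral, and conjugation by U, being
  linear, comes out of it.\<close>

lemma conj_op_twirl:
  assumes H: "haar_SU \<mu>" and U: "U \<in> SUset"
  shows "conj_op t U (twirl t \<mu> (\<lambda>K. K) \<rho>) = twirl t \<mu> (\<lambda>K. K) \<rho>"
proof (intro ext)
  fix i j
  note b = bounded_family_haar[OF H]
  have s: "sets \<mu> = sets borel" and inv: "distr \<mu> borel (\<lambda>K. U ** K) = \<mu>"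
    using H U by (simp_all add: haar_SU_def)
  have meas: "(\<lambda>K. U ** K) \<in> measurable \<mu> borel"
    unfolding measurable_cong_sets[OF s refl] matrix_matrix_mult_def
    by (intro borel_measurable_continuous_onI continuous_intros continuous_on_vec_lambda)
  have f: "(\<lambda>K. conj_op t K \<rho> i j) \<in> borel_measurable borel"
    using borel_measurable_integrable[OF integrable_conj_op[OF b]]
    unfolding measurable_cong_sets[OF s refl] .
  have "twirl t \<mu> (\<lambda>K. K) \<rho> i j = (\<integral>K. conj_op t K \<rho> i j \<partial>distr \<mu> borel (\<lambda>K. U ** K))"
    unfolding inv twirl_def ..
  also have "\<dots> = (\<integral>K. conj_op t U (conj_op t K \<rho>) i j \<partial>\<mu>)"
    by (subst integral_distr[OF meas f]) (simp add: conj_op_mult)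
  also have "\<dots> = conj_op t U (twirl t \<mu> (\<lambda>K. K) \<rho>) i j"
    unfolding conj_op_kernel[of t U] twirl_def
    by (simp add: Bochner_Integration.integral_sum integrable_conj_op[OF b])
  finally show "conj_op t U (twirl t \<mu> (\<lambda>K. K) \<rho>) i j = twirl t \<mu> (\<lambda>K. K) \<rho> i j" by simp
qed

lemma opmul_tpow_mat_1:
  "j \<in> tidx t \<Longrightarrow> opmul t X (tpow t (mat 1)) i j = X i j"
  by (simp add: opmul_def tpow_mat_1 mult.commute[of "X _ _"] eq_commute[of _ j] sum_of_bool_mult
      cong: sum.cong)

text \<open>Multiply U C U^dagger = C by U on the right. The cancelled U^dagger U acts as an
  identity on columns indexed by \<open>tidx t\<close>, hence the condition on j.\<close>

lemma twirl_commute_SU: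
  assumes H: "haar_SU \<mu>" and U: "U \<in> SUset" and j: "j \<in> tidx t"
  shows "opmul t (twirl t \<mu> (\<lambda>K. K) \<rho>) (tpow t U) i j = opmul t (tpow t U) (twirl t \<mu> (\<lambda>K. K) \<rho>) i j"
proof -
  let ?C = "twirl t \<mu> (\<lambda>K. K) \<rho>"
  have "adjm U ** U = mat 1"
    using U by (simp add: SUset_def matrix_left_right_inverse)
  then have "opmul t (conj_op t U ?C) (tpow t U) i j = opmul t (opmul t (tpow t U) ?C) (tpow t (mat 1)) i j"
    by (simp add: conj_op_def opmul_assoc flip: tpow_mult)
  then show ?thesis
    by (simp add: conj_op_twirl[OF H U] opmul_tpow_mat_1[OF j])
qed

section \<open>Schur coordinates\<close>

lemma finite_young_diagrams: "finite (young_diagrams t d)"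
proof (rule finite_subset)
  show "young_diagrams t d \<subseteq> {xs. set xs \<subseteq> {..t} \<and> length xs \<le> d}"
    by (auto simp: young_diagrams_def intro: member_le_sum_list)
qed (rule finite_lists_length_le, simp)

locale schur_decomposition =
  fixes t :: nat and DL DV :: "nat list \<Rightarrow> nat"
    and b :: "nat list \<Rightarrow> nat \<Rightarrow> nat \<Rightarrow> ('d::finite) tvec"
    and \<pi> :: "nat list \<Rightarrow> complex^'d^'d \<Rightarrow> nat \<Rightarrow> nat \<Rightarrow> complex"
    and \<sigma> :: "nat list \<Rightarrow> (nat \<Rightarrow> nat) \<Rightarrow> nat \<Rightarrow> nat \<Rightarrow> complex"
  assumes schur: "schur_basis t DL DV b \<pi> \<sigma>"
begin

definition idx :: "(nat list \<times> nat \<times> nat) set" where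
  "idx = Sigma (young_diagrams t CARD('d)) (\<lambda>k. {1..DL k} \<times> {1..DV k})"

definition basis_vec :: "nat list \<times> nat \<times> nat \<Rightarrow> 'd tvec" where
  "basis_vec = (\<lambda>(k, m, l). b k m l)"

definition coord :: "'d top \<Rightarrow> nat list \<times> nat \<times> nat \<Rightarrow> nat list \<times> nat \<times> nat \<Rightarrow> complex" where
  "coord X a c = vinner t (basis_vec a) (opapp t X (basis_vec c))"

text \<open>Entry (l1, l2) of the partial trace of block k over the m-register; it equals the
  coefficient Tr(X Pi^dagger) in \<open>TU\<close>, as \<open>optr_Pi_ll\<close> shows.\<close>

definition block_tr :: "nat list \<Rightarrow> nat \<Rightarrow> nat \<Rightarrow> 'd top \<Rightarrow> complex" where
  "block_tr k l1 l2 X = (\<Sum>m=1..DL k. coord X (k, m, l1) (k, m, l2))"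

lemma finite_idx [simp]: "finite idx"
  by (auto simp: idx_def finite_young_diagrams)

lemma in_idx [simp]: "(k, m, l) \<in> idx \<longleftrightarrow> k \<in> young_diagrams t CARD('d) \<and> m \<in> {1..DL k} \<and> l \<in> {1..DV k}"
  by (simp add: idx_def)

lemma sum_idx: "(\<Sum>a\<in>idx. f a) = (\<Sum>k\<in>young_diagrams t CARD('d). \<Sum>m=1..DL k. \<Sum>l=1..DV k. f (k, m, l))"
  by (simp add: idx_def finite_young_diagrams sum.Sigma sum.cartesian_product split_beta)

lemma vinner_basis_vec: "a \<in> idx \<Longrightarrow> c \<in> idx \<Longrightarrow> vinner t (basis_vec a) (basis_vec c) = of_bool (a = c)"
  using schur by (cases a, cases c) (auto simp: schur_basis_def Let_def basis_vec_def)

lemma basis_vec_expansion: "i \<in> tidx t \<Longrightarrow> v i = (\<Sum>a\<in>idx. vinner t (basis_vec a) v * basis_vec a i)"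
  using schur unfolding sum_idx by (simp add: schur_basis_def Let_def basis_vec_def)

lemma tpow_basis_vec:
  assumes "X \<in> GLset" "(k, m, l) \<in> idx" "i \<in> tidx t"
  shows "opapp t (tpow t X) (basis_vec (k, m, l)) i = (\<Sum>m'=1..DL k. \<pi> k X m' m * basis_vec (k, m', l) i)"
  using schur assms by (simp add: schur_basis_def Let_def basis_vec_def)

lemma DL_pos: "k \<in> young_diagrams t CARD('d) \<Longrightarrow> 0 < DL k" and DV_pos: "k \<in> young_diagrams t CARD('d) \<Longrightarrow> 0 < DV k"
  using schur by (auto simp: schur_basis_def Let_def irreducible_rep_def)

lemma irreducible_GL: "k \<in> young_diagrams t CARD('d) \<Longrightarrow> irreducible_rep (DL k) GLset (\<pi> k)"
  using schur by (auto simp: schur_basis_def Let_def)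

lemma inequivalent_GL:
  "k \<in> young_diagrams t CARD('d) \<Longrightarrow> k' \<in> young_diagrams t CARD('d) \<Longrightarrow> k \<noteq> k' \<Longrightarrow> \<not> equivalent_rep (DL k) (DL k') GLset (\<pi> k) (\<pi> k')"
  using schur unfolding schur_basis_def Let_def by blast

text \<open>The expansion axiom applied to the unit vector at j.\<close>

lemma basis_vec_complete:
  assumes "i \<in> tidx t" "j \<in> tidx t"
  shows "(\<Sum>a\<in>idx. basis_vec a i * cnj (basis_vec a j)) = of_bool (j = i)"
proof -
  have "vinner t (basis_vec a) (\<lambda>i. of_bool (j = i)) = cnj (basis_vec a j)" for a
    using assms(2) sum_of_bool_mult[of "tidx t" j "\<lambda>i. cnj (basis_vec a i)"] by (simp add: vinner_def mult.commute)
  then show ?thesis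
    using basis_vec_expansion[OF assms(1), of "\<lambda>i. of_bool (j = i)"] by (simp add: mult.commute)
qed

lemma coord_sum: "coord X a c = (\<Sum>i\<in>tidx t. \<Sum>j\<in>tidx t. cnj (basis_vec a i) * X i j * basis_vec c j)"
  by (simp add: coord_def vinner_def opapp_def sum_distrib_left mult.assoc)

text \<open>Inverse of the change of basis: completeness is inserted on the column side, and then
  the resulting column vector is expanded.\<close>

lemma entry_coord:
  assumes "i \<in> tidx t" "j \<in> tidx t"
  shows "X i j = (\<Sum>a\<in>idx. \<Sum>c\<in>idx. basis_vec a i * coord X a c * cnj (basis_vec c j))"
proof -
  have col: "X i' j = (\<Sum>c\<in>idx. opapp t X (basis_vec c) i' * cnj (basis_vec c j))" for i'
  proof -
    have "X i' j = (\<Sum>j'\<in>tidx t. of_bool (j = j') * X i' j')"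
      using assms(2) by (simp add: sum_of_bool_mult)
    also have "\<dots> = (\<Sum>j'\<in>tidx t. (\<Sum>c\<in>idx. basis_vec c j' * cnj (basis_vec c j)) * X i' j')"
      using assms(2) by (intro sum.cong refl) (simp only: basis_vec_complete)
    also have "\<dots> = (\<Sum>c\<in>idx. \<Sum>j'\<in>tidx t. basis_vec c j' * cnj (basis_vec c j) * X i' j')"
      unfolding sum_distrib_right by (rule sum.swap)
    finally show ?thesis by (simp add: opapp_def sum_distrib_left mult_ac)
  qed
  have "vinner t (basis_vec a) (\<lambda>i. X i j) = (\<Sum>c\<in>idx. coord X a c * cnj (basis_vec c j))" for a
  proof -
    have "vinner t (basis_vec a) (\<lambda>i. X i j)
        = (\<Sum>i'\<in>tidx t. \<Sum>c\<in>idx. cnj (basis_vec a i') * (opapp t X (basis_vec c) i' * cnj (basis_vec c j)))"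
      unfolding vinner_def col sum_distrib_left ..
    also have "\<dots> = (\<Sum>c\<in>idx. \<Sum>i'\<in>tidx t. cnj (basis_vec a i') * (opapp t X (basis_vec c) i' * cnj (basis_vec c j)))"
      by (rule sum.swap)
    finally show ?thesis by (simp add: coord_def vinner_def sum_distrib_right mult.assoc)
  qed
  then show ?thesis
    using basis_vec_expansion[OF assms(1), of "\<lambda>i. X i j"] by (simp add: sum_distrib_left mult_ac)
qed

lemma coord_opmul: "coord (opmul t X Z) a c = (\<Sum>e\<in>idx. coord X a e * coord Z e c)"
proof -
  have app: "opapp t (opmul t X Z) v = opapp t X (opapp t Z v)" for v
    by (simp add: fun_eq_iff opapp_def opmul_def sum_distrib_left sum_distrib_right mult.assoc)
       (intro allI sum.swap)
  have "opapp t X (opapp t Z (basis_vec c)) i = (\<Sum>e\<in>idx. coord Z e c * opapp t X (basis_vec e) i)" for i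
  proof -
    have "opapp t X (opapp t Z (basis_vec c)) i = (\<Sum>j\<in>tidx t. X i j * (\<Sum>e\<in>idx. coord Z e c * basis_vec e j))"
      unfolding opapp_def[of t X] coord_def by (intro sum.cong refl arg_cong2[of _ _ _ _ "(*)"] basis_vec_expansion)
    also have "\<dots> = (\<Sum>e\<in>idx. coord Z e c * opapp t X (basis_vec e) i)"
      unfolding opapp_def sum_distrib_left by (subst sum.swap) (simp add: mult_ac)
    finally show ?thesis .
  qed
  then have "coord (opmul t X Z) a c
      = (\<Sum>i\<in>tidx t. \<Sum>e\<in>idx. coord Z e c * (cnj (basis_vec a i) * opapp t X (basis_vec e) i))"
    by (simp add: coord_def[of "opmul t X Z"] app vinner_def sum_distrib_left mult_ac)
  also have "\<dots> = (\<Sum>e\<in>idx. coord X a e * coord Z e c)"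
    by (subst sum.swap) (simp add: coord_def[of X] vinner_def sum_distrib_left mult_ac)
  finally show ?thesis .
qed

lemma coord_tpow:
  assumes X: "X \<in> GLset" and "(k, m, l) \<in> idx" "(k', m', l') \<in> idx"
  shows "coord (tpow t X) (k, m, l) (k', m', l') = of_bool (k = k' \<and> l = l') * \<pi> k' X m m'"
proof -
  have "coord (tpow t X) (k, m, l) (k', m', l')
     = (\<Sum>i\<in>tidx t. cnj (basis_vec (k, m, l) i) * (\<Sum>m''=1..DL k'. \<pi> k' X m'' m' * basis_vec (k', m'', l') i))"
    unfolding coord_def vinner_def by (intro sum.cong refl) (simp add: tpow_basis_vec[OF X assms(3)])
  also have "\<dots> = (\<Sum>m''=1..DL k'. \<pi> k' X m'' m' * vinner t (basis_vec (k, m, l)) (basis_vec (k', m'', l')))"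
    by (simp add: vinner_def sum_distrib_left mult_ac) (rule sum.swap)
  also have "\<dots> = (\<Sum>m''=1..DL k'. of_bool (m = m'') * (of_bool (k = k' \<and> l = l') * \<pi> k' X m'' m'))"
    using assms(2,3) by (intro sum.cong refl) (subst vinner_basis_vec, auto)
  also have "\<dots> = of_bool (k = k' \<and> l = l') * \<pi> k' X m m'"
  proof (cases "k = k'")
    case True
    then show ?thesis using assms(2) by (intro sum_of_bool_mult) auto
  qed simp
  finally show ?thesis .
qed

lemma coord_opadj: "coord (opadj X) a c = cnj (coord X c a)"
  by (simp add: coord_sum opadj_def mult_ac) (rule sum.swap)

lemma coord_cong:
  "(\<And>i j. i \<in> tidx t \<Longrightarrow> j \<in> tidx t \<Longrightarrow> X i j = Z i j) \<Longrightarrow> coord X a c = coord Z a c"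
  by (simp add: coord_sum)

lemma optr_Pi_ll: "optr t (opmul t X (opadj (Pi_ll DL b k l1 l2))) = block_tr k l1 l2 X"
proof -
  have "optr t (opmul t X (opadj (Pi_ll DL b k l1 l2))) =
     (\<Sum>i\<in>tidx t. \<Sum>j\<in>tidx t. \<Sum>m=1..DL k. cnj (basis_vec (k, m, l1) i) * X i j * basis_vec (k, m, l2) j)"
    by (simp add: optr_def opmul_def opadj_def Pi_ll_def sum_distrib_left basis_vec_def mult_ac)
  also have "\<dots> = (\<Sum>m=1..DL k. \<Sum>i\<in>tidx t. \<Sum>j\<in>tidx t. cnj (basis_vec (k, m, l1) i) * X i j * basis_vec (k, m, l2) j)"
    by (simp only: sum.swap[of _ "{1..DL k}"])
  finally show ?thesis by (simp add: block_tr_def coord_sum)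
qed

lemma optr_Pi_k: "optr t (opmul t X (opadj (Pi_k DL DV b k))) = (\<Sum>l=1..DV k. block_tr k l l X)"
proof -
  have "Pi_k DL DV b k i j = (\<Sum>l=1..DV k. Pi_ll DL b k l l i j)" for i j
    unfolding Pi_k_def Pi_ll_def by (rule sum.swap)
  then have "optr t (opmul t X (opadj (Pi_k DL DV b k)))
     = (\<Sum>i\<in>tidx t. \<Sum>j\<in>tidx t. \<Sum>l=1..DV k. X i j * opadj (Pi_ll DL b k l l) j i)"
    by (simp add: optr_def opmul_def opadj_def sum_distrib_left)
  also have "\<dots> = (\<Sum>l=1..DV k. \<Sum>i\<in>tidx t. \<Sum>j\<in>tidx t. X i j * opadj (Pi_ll DL b k l l) j i)"
    by (simp only: sum.swap[of _ "{1..DV k}"])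
  also have "\<dots> = (\<Sum>l=1..DV k. optr t (opmul t X (opadj (Pi_ll DL b k l l))))"
    by (simp add: optr_def opmul_def)
  finally show ?thesis by (simp add: optr_Pi_ll)
qed

text \<open>The trace does not depend on the orthonormal basis: adding the diagonal Schur
  coordinates and using completeness gives back the diagonal entries.\<close>

lemma optr_block_tr: "optr t X = (\<Sum>k\<in>young_diagrams t CARD('d). \<Sum>l=1..DV k. block_tr k l l X)"
proof -
  have "(\<Sum>k\<in>young_diagrams t CARD('d). \<Sum>l=1..DV k. block_tr k l l X) = (\<Sum>a\<in>idx. coord X a a)"
    unfolding sum_idx block_tr_def by (intro sum.cong refl sum.swap)
  also have "\<dots> = (\<Sum>i\<in>tidx t. \<Sum>j\<in>tidx t. \<Sum>a\<in>idx. X i j * (basis_vec a j * cnj (basis_vec a i)))"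
    by (simp only: coord_sum sum.swap[of _ "tidx t" idx]) (simp add: mult_ac)
  also have "\<dots> = (\<Sum>i\<in>tidx t. \<Sum>j\<in>tidx t. of_bool (i = j) * X i j)"
    by (intro sum.cong refl) (simp add: basis_vec_complete mult.commute flip: sum_distrib_left)
  also have "\<dots> = optr t X" by (simp add: optr_def sum_of_bool_mult)
  finally show ?thesis by simp
qed

lemma TU_block_tr:
  "TU t DL DV b k X i j =
     (1 / of_nat (DL k)) * (\<Sum>l1=1..DV k. \<Sum>l2=1..DV k. block_tr k l1 l2 X * Pi_ll DL b k l1 l2 i j)"
  by (simp add: TU_def optr_Pi_ll)

section \<open>Block structure of tensor powers in Schur coordinates\<close>

lemma sum_idx_block:
  assumes "k \<in> young_diagrams t CARD('d)" "l \<in> {1..DV k}"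
    and "\<And>k' m' l'. (k', m', l') \<in> idx \<Longrightarrow> \<not> (k = k' \<and> l = l') \<Longrightarrow> h (k', m', l') = 0"
  shows "(\<Sum>e\<in>idx. h e) = (\<Sum>n=1..DL k. h (k, n, l))"
proof -
  let ?B = "(\<lambda>n. (k, n, l)) ` {1..DL k}"
  have "(\<Sum>e\<in>idx. h e) = (\<Sum>e\<in>?B. h e)"
  proof (rule sum.mono_neutral_right)
    show "?B \<subseteq> idx" using assms(1,2) by auto
    show "\<forall>e\<in>idx - ?B. h e = 0"
    proof
      fix e assume e: "e \<in> idx - ?B"
      obtain k' m' l' where e': "e = (k', m', l')" by (metis prod.collapse)
      show "h e = 0" unfolding e' using e e' by (intro assms(3)) auto
    qed
  qed simp
  also have "\<dots> = (\<Sum>n=1..DL k. h (k, n, l))"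
    by (subst sum.reindex) (auto simp: inj_on_def)
  finally show ?thesis .
qed

lemma coord_opmul_tpow_right:
  assumes X: "X \<in> GLset" and kml: "(k, m, l) \<in> idx"
  shows "coord (opmul t Z (tpow t X)) a (k, m, l) = (\<Sum>n=1..DL k. coord Z a (k, n, l) * \<pi> k X n m)"
proof -
  have "coord (opmul t Z (tpow t X)) a (k, m, l)
      = (\<Sum>n=1..DL k. coord Z a (k, n, l) * coord (tpow t X) (k, n, l) (k, m, l))"
    unfolding coord_opmul using kml by (intro sum_idx_block) (auto simp: coord_tpow[OF X])
  also have "\<dots> = (\<Sum>n=1..DL k. coord Z a (k, n, l) * \<pi> k X n m)"
    using kml by (intro sum.cong refl) (simp add: coord_tpow[OF X])
  finally show ?thesis .
qed

lemma coord_opmul_tpow_left: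
  assumes X: "X \<in> GLset" and kml: "(k, m, l) \<in> idx"
  shows "coord (opmul t (tpow t X) Z) (k, m, l) c = (\<Sum>n=1..DL k. \<pi> k X m n * coord Z (k, n, l) c)"
proof -
  have "coord (opmul t (tpow t X) Z) (k, m, l) c
      = (\<Sum>n=1..DL k. coord (tpow t X) (k, m, l) (k, n, l) * coord Z (k, n, l) c)"
    unfolding coord_opmul using kml by (intro sum_idx_block) (auto simp: coord_tpow[OF X])
  also have "\<dots> = (\<Sum>n=1..DL k. \<pi> k X m n * coord Z (k, n, l) c)"
    using kml by (intro sum.cong refl) (simp add: coord_tpow[OF X])
  finally show ?thesis .
qed

lemma coord_mat_1:
  assumes "a \<in> idx" "c \<in> idx"
  shows "coord (tpow t (mat 1)) a c = of_bool (a = c)"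
proof -
  have "opapp t (tpow t (mat 1)) v i = v i" if "i \<in> tidx t" for v :: "'d tvec" and i
    using that by (simp add: opapp_def tpow_mat_1 sum_of_bool_mult cong: sum.cong)
  then have "coord (tpow t (mat 1)) a c = vinner t (basis_vec a) (basis_vec c)"
    by (simp add: coord_def vinner_def)
  then show ?thesis using assms by (simp add: vinner_basis_vec)
qed

text \<open>Unitarity of the representation matrices is derived: the tensor power of K is unitary
  and the Schur basis orthonormal. It is read off at l = 1, a valid index since \<open>DV k\<close>
  is positive.\<close>

lemma pi_unitary:
  assumes K: "K \<in> SUset" and k: "k \<in> young_diagrams t CARD('d)" and n: "n \<in> {1..DL k}" "n' \<in> {1..DL k}"
  shows "(\<Sum>m=1..DL k. \<pi> k K m n * cnj (\<pi> k K m n')) = of_bool (n' = n)"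
proof -
  have KG: "K \<in> GLset" using K SUset_subset_GLset by blast
  have l: "1 \<in> {1..DV k}" using DV_pos[OF k] by simp
  have "adjm K ** K = mat 1" using K by (simp add: SUset_def matrix_left_right_inverse)
  then have "of_bool (n' = n) = coord (opmul t (opadj (tpow t K)) (tpow t K)) (k, n', 1) (k, n, 1)"
    using k n l coord_mat_1[of "(k, n', 1)" "(k, n, 1)"] by (simp flip: tpow_mult tpow_adjm)
  also have "\<dots> = (\<Sum>m=1..DL k. \<pi> k K m n * cnj (\<pi> k K m n'))"
    using k n l by (subst coord_opmul_tpow_right[OF KG])
      (auto intro!: sum.cong simp: coord_opadj coord_tpow[OF KG])
  finally show ?thesis by simp
qed

lemma pi_hermitian:
  assumes X: "X \<in> GLset" "adjm X = X" and k: "k \<in> young_diagrams t CARD('d)"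
    and n: "n \<in> {1..DL k}" "m \<in> {1..DL k}"
  shows "cnj (\<pi> k X m n) = \<pi> k X n m"
proof -
  have l: "1 \<in> {1..DV k}" using DV_pos[OF k] by simp
  have "coord (tpow t (adjm X)) (k, n, 1) (k, m, 1) = cnj (coord (tpow t X) (k, m, 1) (k, n, 1))"
    unfolding tpow_adjm coord_opadj ..
  then show ?thesis using k n l X by (simp add: coord_tpow)
qed

lemma block_tr_conj_op:
  assumes X: "X \<in> GLset" and k: "k \<in> young_diagrams t CARD('d)"
    and l: "l1 \<in> {1..DV k}" "l2 \<in> {1..DV k}"
  shows "block_tr k l1 l2 (conj_op t X \<rho>) = (\<Sum>m=1..DL k. \<Sum>n=1..DL k. \<Sum>n'=1..DL k.
     \<pi> k X m n * coord \<rho> (k, n, l1) (k, n', l2) * cnj (\<pi> k X m n'))"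
  unfolding block_tr_def
proof (intro sum.cong refl)
  fix m assume m: "m \<in> {1..DL k}"
  have "coord (conj_op t X \<rho>) (k, m, l1) (k, m, l2) =
     (\<Sum>e\<in>idx. coord (opmul t (tpow t X) \<rho>) (k, m, l1) e * cnj (coord (tpow t X) (k, m, l2) e))"
    unfolding conj_op_def coord_opmul[of "opmul t (tpow t X) \<rho>"] tpow_adjm coord_opadj ..
  also have "\<dots> = (\<Sum>n'=1..DL k. coord (opmul t (tpow t X) \<rho>) (k, m, l1) (k, n', l2)
      * cnj (coord (tpow t X) (k, m, l2) (k, n', l2)))"
    using k l m by (intro sum_idx_block) (auto simp: coord_tpow[OF X])
  also have "\<dots> = (\<Sum>n'=1..DL k. \<Sum>n=1..DL k. \<pi> k X m n * coord \<rho> (k, n, l1) (k, n', l2) * cnj (\<pi> k X m n'))"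
    using k l m
    by (intro sum.cong refl) (simp add: coord_opmul_tpow_left[OF X] coord_tpow[OF X] sum_distrib_right)
  also have "\<dots> = (\<Sum>n=1..DL k. \<Sum>n'=1..DL k. \<pi> k X m n * coord \<rho> (k, n, l1) (k, n', l2) * cnj (\<pi> k X m n'))"
    by (rule sum.swap)
  finally show "coord (conj_op t X \<rho>) (k, m, l1) (k, m, l2) = \<dots>" .
qed

text \<open>A partial trace over the m-register is cyclic for operators acting on that register, so
  the unitary representation matrix cancels against its adjoint.\<close>

lemma block_tr_conj_op_SU:
  assumes K: "K \<in> SUset" and k: "k \<in> young_diagrams t CARD('d)"
    and l: "l1 \<in> {1..DV k}" "l2 \<in> {1..DV k}"
  shows "block_tr k l1 l2 (conj_op t K \<rho>) = block_tr k l1 l2 \<rho>"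
proof -
  let ?c = "\<lambda>n n'. coord \<rho> (k, n, l1) (k, n', l2)"
  have KG: "K \<in> GLset" using K SUset_subset_GLset by blast
  have "block_tr k l1 l2 (conj_op t K \<rho>)
      = (\<Sum>n=1..DL k. \<Sum>m=1..DL k. \<Sum>n'=1..DL k. \<pi> k K m n * ?c n n' * cnj (\<pi> k K m n'))"
    unfolding block_tr_conj_op[OF KG k l] by (rule sum.swap)
  also have "\<dots> = (\<Sum>n=1..DL k. \<Sum>n'=1..DL k. \<Sum>m=1..DL k. \<pi> k K m n * ?c n n' * cnj (\<pi> k K m n'))"
    by (intro sum.cong refl sum.swap)
  also have "\<dots> = (\<Sum>n=1..DL k. \<Sum>n'=1..DL k. ?c n n' * (\<Sum>m=1..DL k. \<pi> k K m n * cnj (\<pi> k K m n')))"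
    by (simp add: sum_distrib_left mult_ac)
  also have "\<dots> = (\<Sum>n=1..DL k. \<Sum>n'=1..DL k. of_bool (n = n') * ?c n n')"
  proof (intro sum.cong refl)
    fix n n' assume "n \<in> {1..DL k}" "n' \<in> {1..DL k}"
    then have "(\<Sum>m=1..DL k. \<pi> k K m n * cnj (\<pi> k K m n')) = of_bool (n = n')"
      using pi_unitary[OF K k, of n n'] by (cases "n = n'") auto
    then show "?c n n' * (\<Sum>m=1..DL k. \<pi> k K m n * cnj (\<pi> k K m n')) = of_bool (n = n') * ?c n n'"
      by simp
  qed
  also have "\<dots> = (\<Sum>n=1..DL k. ?c n n)"
    by (intro sum.cong refl sum_of_bool_mult) auto
  finally show ?thesis by (simp add: block_tr_def)
qed

text \<open>For fixed k, l, k', l' the coordinates of C form an intertwiner from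
  \<open>\<pi> k'\<close> to \<open>\<pi> k\<close>: zero if the labels differ, scalar if they
  agree.\<close>

lemma schur_coord:
  assumes comm: "\<And>K i j. K \<in> SUset \<Longrightarrow> i \<in> tidx t \<Longrightarrow> j \<in> tidx t \<Longrightarrow>
       opmul t C (tpow t K) i j = opmul t (tpow t K) C i j"
    and a: "(k, m, l) \<in> idx" and c: "(k', m', l') \<in> idx"
  shows "coord C (k, m, l) (k', m', l') = of_bool (k = k') * (of_bool (m = m') * (block_tr k l l' C / of_nat (DL k)))"
proof -
  define S where "S = (\<lambda>i j. coord C (k, i, l) (k', j, l'))"
  have int: "(\<Sum>n=1..DL k'. S i n * \<pi> k' X n j) = (\<Sum>n=1..DL k. \<pi> k X i n * S n j)"
    if X: "X \<in> GLset" and i: "i \<in> {1..DL k}" and j: "j \<in> {1..DL k'}" for X i j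
  proof -
    have "coord (opmul t C (tpow t X)) (k, i, l) (k', j, l') = coord (opmul t (tpow t X) C) (k, i, l) (k', j, l')"
      by (intro coord_cong commute_SU_imp_commute_GL[OF comm X])
    then show ?thesis
      using a c i j by (simp add: coord_opmul_tpow_left[OF X] coord_opmul_tpow_right[OF X] S_def)
  qed
  have kk: "k \<in> young_diagrams t CARD('d)" "k' \<in> young_diagrams t CARD('d)" "m \<in> {1..DL k}" "m' \<in> {1..DL k'}"
    using a c by auto
  show ?thesis
  proof (cases "k = k'")
    case True
    have "\<exists>s. \<forall>i\<in>{1..DL k}. \<forall>j\<in>{1..DL k}. S i j = (if i = j then s else 0)"
      using int True by (intro schur_scalar[OF irreducible_GL[OF kk(1)]]) simp
    then obtain s where s: "\<And>i j. i \<in> {1..DL k} \<Longrightarrow> j \<in> {1..DL k} \<Longrightarrow> S i j = (if i = j then s else 0)"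
      by blast
    have "block_tr k l l' C = (\<Sum>m=1..DL k. S m m)" by (simp add: block_tr_def S_def True)
    also have "\<dots> = of_nat (DL k) * s" using s by simp
    \<comment> \<open>The scalar is fixed by the trace of the block.\<close>
    finally have "s = block_tr k l l' C / of_nat (DL k)" using DL_pos[OF kk(1)] by simp
    then show ?thesis using s[of m m'] kk True by (simp add: S_def)
  next
    case False
    have "S m m' = 0"
    proof (rule ccontr)
      assume "S m m' \<noteq> 0"
      then have "equivalent_rep (DL k') (DL k) GLset (\<pi> k') (\<pi> k)"
        using int kk by (intro schur_nonzero_intertwiner[OF irreducible_GL irreducible_GL]) auto
      then show False using inequivalent_GL[of k' k] kk False by blast
    qed
    then show ?thesis using False by (simp add: S_def)
  qed
qed

text \<open>In the expansion of C, the coefficients from \<open>schur_coord\<close> do not depend on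
  m, so the sum over m assembles the outer products into \<open>Pi_ll\<close>.\<close>

lemma commutant_eq_TU:
  assumes comm: "\<And>K i j. K \<in> SUset \<Longrightarrow> i \<in> tidx t \<Longrightarrow> j \<in> tidx t \<Longrightarrow>
       opmul t C (tpow t K) i j = opmul t (tpow t K) C i j"
    and i: "i \<in> tidx t" and j: "j \<in> tidx t"
  shows "C i j = (\<Sum>k\<in>young_diagrams t CARD('d). TU t DL DV b k C i j)"
proof -
  let ?g = "\<lambda>k l l'. block_tr k l l' C / of_nat (DL k)"
  have row: "(\<Sum>c\<in>idx. basis_vec (k, m, l) i * coord C (k, m, l) c * cnj (basis_vec c j))
      = (\<Sum>l'=1..DV k. ?g k l l' * (b k m l i * cnj (b k m l' j)))"
    if a: "(k, m, l) \<in> idx" for k m l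
  proof -
    have "(\<Sum>c\<in>idx. basis_vec (k, m, l) i * coord C (k, m, l) c * cnj (basis_vec c j))
        = (\<Sum>k'\<in>young_diagrams t CARD('d). of_bool (k = k') * (\<Sum>m'=1..DL k'. of_bool (m = m') *
            (\<Sum>l'=1..DV k'. ?g k l l' * (b k m l i * cnj (b k' m' l' j)))))"
      unfolding sum_idx sum_distrib_left
      by (intro sum.cong refl) (subst schur_coord[OF comm a], auto simp: basis_vec_def)
    also have "\<dots> = (\<Sum>m'=1..DL k. of_bool (m = m') *
            (\<Sum>l'=1..DV k. ?g k l l' * (b k m l i * cnj (b k m' l' j))))"
      using a by (intro sum_of_bool_mult) (auto simp: finite_young_diagrams)
    also have "\<dots> = (\<Sum>l'=1..DV k. ?g k l l' * (b k m l i * cnj (b k m l' j)))"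
      using a by (intro sum_of_bool_mult) auto
    finally show ?thesis .
  qed
  have "C i j = (\<Sum>k\<in>young_diagrams t CARD('d). \<Sum>m=1..DL k. \<Sum>l=1..DV k.
      \<Sum>l'=1..DV k. ?g k l l' * (b k m l i * cnj (b k m l' j)))"
    unfolding entry_coord[OF i j, of C] sum_idx[of "\<lambda>a. \<Sum>c\<in>idx. _ a c"]
    by (intro sum.cong refl row) auto
  also have "\<dots> = (\<Sum>k\<in>young_diagrams t CARD('d). TU t DL DV b k C i j)"
  proof (intro sum.cong refl)
    fix k
    have "(\<Sum>m=1..DL k. \<Sum>l=1..DV k. \<Sum>l'=1..DV k. ?g k l l' * (b k m l i * cnj (b k m l' j)))
       = (\<Sum>l=1..DV k. \<Sum>m=1..DL k. \<Sum>l'=1..DV k. ?g k l l' * (b k m l i * cnj (b k m l' j)))"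
      by (rule sum.swap)
    also have "\<dots> = (\<Sum>l=1..DV k. \<Sum>l'=1..DV k. \<Sum>m=1..DL k. ?g k l l' * (b k m l i * cnj (b k m l' j)))"
      by (intro sum.cong refl sum.swap)
    also have "\<dots> = TU t DL DV b k C i j"
      by (simp add: TU_block_tr Pi_ll_def sum_distrib_left)
    finally show "(\<Sum>m=1..DL k. \<Sum>l=1..DV k. \<Sum>l'=1..DV k. ?g k l l' * (b k m l i * cnj (b k m l' j)))
       = TU t DL DV b k C i j" .
  qed
  finally show ?thesis .
qed

section \<open>Partial traces of averages and the origin of beta_k / D^k\<close>

lemma
  assumes F: "\<And>i j. integrable \<mu> (\<lambda>x. F x i j)"
  shows integrable_block_tr: "integrable \<mu> (\<lambda>x. block_tr k l1 l2 (F x))"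
    and block_tr_integral: "block_tr k l1 l2 (\<lambda>i j. \<integral>x. F x i j \<partial>\<mu>) = (\<integral>x. block_tr k l1 l2 (F x) \<partial>\<mu>)"
proof -
  note F' = integrable_mult_left[OF integrable_mult_right[OF F]]
  show "integrable \<mu> (\<lambda>x. block_tr k l1 l2 (F x))"
    unfolding block_tr_def coord_sum by (intro Bochner_Integration.integrable_sum F')
  show "block_tr k l1 l2 (\<lambda>i j. \<integral>x. F x i j \<partial>\<mu>) = (\<integral>x. block_tr k l1 l2 (F x) \<partial>\<mu>)"
    unfolding block_tr_def coord_sum
    by (simp add: Bochner_Integration.integral_sum Bochner_Integration.integrable_sum F F')
qed

lemma block_tr_twirl_SU:
  assumes H: "haar_SU \<mu>" and k: "k \<in> young_diagrams t CARD('d)"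
    and l: "l1 \<in> {1..DV k}" "l2 \<in> {1..DV k}"
  shows "block_tr k l1 l2 (twirl t \<mu> (\<lambda>K. K) \<rho>) = block_tr k l1 l2 \<rho>"
proof -
  interpret prob_space \<mu> using H by (simp add: haar_SU_def)
  note int = integrable_conj_op[OF bounded_family_haar[OF H]]
  have "AE K in \<mu>. K \<in> SUset" using H by (simp add: haar_SU_def)
  then have "AE K in \<mu>. block_tr k l1 l2 (conj_op t K \<rho>) = block_tr k l1 l2 \<rho>"
    by eventually_elim (rule block_tr_conj_op_SU[OF _ k l])
  then have "(\<integral>K. block_tr k l1 l2 (conj_op t K \<rho>) \<partial>\<mu>) = (\<integral>K. block_tr k l1 l2 \<rho> \<partial>\<mu>)"
    by (intro integral_cong_AE borel_measurable_integrable[OF integrable_block_tr[OF int]]) auto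
  then show ?thesis
    unfolding twirl_def block_tr_integral[OF int] by (simp add: prob_space)
qed

text \<open>By hermiticity the trace of the square is a sum of squared moduli. The right-hand side
  is free of l, so every l contributes alike to beta.\<close>

lemma block_tr_normA_square:
  assumes A: "A \<in> Aset" and k: "k \<in> young_diagrams t CARD('d)" and l: "l \<in> {1..DV k}"
  shows "block_tr k l l (opmul t (tpow t (normA A)) (tpow t (normA A)))
     = (\<Sum>m=1..DL k. \<Sum>n=1..DL k. \<pi> k (normA A) m n * cnj (\<pi> k (normA A) m n))"
  using k l
  by (simp add: block_tr_def coord_opmul_tpow_right[OF normA_in_GLset[OF A]] coord_tpow[OF normA_in_GLset[OF A]]
      pi_hermitian[OF normA_in_GLset[OF A] adjm_normA[OF A] k])

lemma beta_eq_integral: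
  assumes A: "prob_space muA" "sets muA = sets borel" "AE A in muA. A \<in> Aset"
    and k: "k \<in> young_diagrams t CARD('d)" and l: "l \<in> {1..DV k}"
  shows "beta t muA DL DV b k
     = of_nat (DV k) * (\<integral>A. block_tr k l l (opmul t (tpow t (normA A)) (tpow t (normA A))) \<partial>muA)"
proof -
  let ?W = "\<lambda>A. opmul t (tpow t (normA A)) (tpow t (normA A)) :: 'd top"
  have int: "integrable muA (\<lambda>A. ?W A i j)" for i j
    unfolding opmul_def
    by (intro Bochner_Integration.integrable_sum integrable_tpow_products(2) bounded_family_normA A)
  have eq: "(\<integral>A. block_tr k l' l' (?W A) \<partial>muA) = (\<integral>A. block_tr k l l (?W A) \<partial>muA)"
    if "l' \<in> {1..DV k}" for l'
  proof (intro integral_cong_AE borel_measurable_integrable[OF integrable_block_tr[OF int]])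
    show "AE A in muA. block_tr k l' l' (?W A) = block_tr k l l (?W A)"
      using A(3) by eventually_elim (simp only: block_tr_normA_square[OF _ k l] block_tr_normA_square[OF _ k that])
  qed
  have "beta t muA DL DV b k = (\<Sum>l'=1..DV k. \<integral>A. block_tr k l' l' (?W A) \<partial>muA)"
    unfolding beta_def optr_Pi_k block_tr_integral[OF int] ..
  also have "\<dots> = (\<Sum>l'=1..DV k. \<integral>A. block_tr k l l (?W A) \<partial>muA)"
    by (intro sum.cong refl eq)
  finally show ?thesis by simp
qed

text \<open>Because C commutes with SU(d), its blocks are scalar; each such scalar factors out of
  the conjugation and leaves the block trace of A_n squared, whose mean is beta_k / D_V.\<close>

lemma block_tr_twirl_normA:
  assumes A: "prob_space muA" "sets muA = sets borel" "AE A in muA. A \<in> Aset"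
    and comm: "\<And>K i j. K \<in> SUset \<Longrightarrow> i \<in> tidx t \<Longrightarrow> j \<in> tidx t \<Longrightarrow>
       opmul t C (tpow t K) i j = opmul t (tpow t K) C i j"
    and k: "k \<in> young_diagrams t CARD('d)" and l: "l1 \<in> {1..DV k}" "l2 \<in> {1..DV k}"
  shows "block_tr k l1 l2 (twirl t muA normA C)
     = beta t muA DL DV b k / of_nat (DL k * DV k) * block_tr k l1 l2 C"
proof -
  let ?W = "\<lambda>A. opmul t (tpow t (normA A)) (tpow t (normA A)) :: 'd top"
  \<comment> \<open>The Schur scalar of block (k, l1, l2), which supplies the factor 1 /
    D_L.\<close>
  let ?q = "block_tr k l1 l2 C / of_nat (DL k)"
  note bA = bounded_family_normA[OF A(1,2)]
  note int = integrable_conj_op[OF bA]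
  have intW: "integrable muA (\<lambda>A. ?W A i j)" for i j
    unfolding opmul_def
    by (intro Bochner_Integration.integrable_sum integrable_tpow_products(2) bA)
  have conj: "block_tr k l1 l2 (conj_op t (normA A) C) = ?q * block_tr k l1 l1 (?W A)" if "A \<in> Aset" for A
  proof -
    let ?p = "\<pi> k (normA A)"
    have "block_tr k l1 l2 (conj_op t (normA A) C)
       = (\<Sum>m=1..DL k. \<Sum>n=1..DL k. \<Sum>n'=1..DL k. of_bool (n = n') * (?q * (?p m n * cnj (?p m n'))))"
      unfolding block_tr_conj_op[OF normA_in_GLset[OF that] k l]
      using k l by (intro sum.cong refl) (subst schur_coord[OF comm], auto)
    also have "\<dots> = (\<Sum>m=1..DL k. \<Sum>n=1..DL k. ?q * (?p m n * cnj (?p m n)))"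
      by (intro sum.cong refl sum_of_bool_mult) auto
    also have "\<dots> = ?q * block_tr k l1 l1 (?W A)"
      unfolding block_tr_normA_square[OF that k l(1)] sum_distrib_left ..
    finally show ?thesis .
  qed
  have "AE A in muA. block_tr k l1 l2 (conj_op t (normA A) C) = ?q * block_tr k l1 l1 (?W A)"
    using A(3) by eventually_elim (rule conj)
  then have "(\<integral>A. block_tr k l1 l2 (conj_op t (normA A) C) \<partial>muA) = (\<integral>A. ?q * block_tr k l1 l1 (?W A) \<partial>muA)"
    by (intro integral_cong_AE borel_measurable_integrable integrable_mult_right
        integrable_block_tr int intW)
  then have "block_tr k l1 l2 (twirl t muA normA C) = ?q * (\<integral>A. block_tr k l1 l1 (?W A) \<partial>muA)"
    unfolding twirl_def block_tr_integral[OF int] by simp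
  then show ?thesis
    using DV_pos[OF k] unfolding beta_eq_integral[OF A k l(1)] by (simp add: field_simps)
qed

section \<open>The SLOCC twirl and its powers\<close>

context
  fixes muH muA :: "(complex^'d^'d) measure"
  assumes H: "haar_SU muH"
    and A: "prob_space muA" "sets muA = sets borel" "AE A in muA. A \<in> Aset"
begin

definition gain :: "nat list \<Rightarrow> complex" where
  "gain k = beta t muA DL DV b k / of_nat (DL k * DV k)"

text \<open>The inner Haar twirl supplies the commutation needed by the average over A_n; both Haar
  twirls leave the block traces alone.\<close>

lemma block_tr_TSL:
  assumes k: "k \<in> young_diagrams t CARD('d)" and l: "l1 \<in> {1..DV k}" "l2 \<in> {1..DV k}"
  shows "block_tr k l1 l2 (TSL t muH muA \<rho>) = gain k * block_tr k l1 l2 \<rho>"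
  unfolding TSL_eq_twirls[OF H A(1,2)] block_tr_twirl_SU[OF H k l] gain_def
  by (subst block_tr_twirl_normA[OF A twirl_commute_SU[OF H] k l])
     (simp_all only: block_tr_twirl_SU[OF H k l])

lemma block_tr_TSL_power:
  assumes "k \<in> young_diagrams t CARD('d)" "l1 \<in> {1..DV k}" "l2 \<in> {1..DV k}"
  shows "block_tr k l1 l2 ((TSL t muH muA ^^ m) \<rho>) = gain k ^ m * block_tr k l1 l2 \<rho>"
  using assms by (induction m) (simp_all add: block_tr_TSL del: atLeastAtMost_iff)

text \<open>The exponent is a successor because the outermost Haar twirl of the last application is
  what puts the result into the commutant; \<open>\<rho>\<close> itself need not lie there.\<close>

lemma TSL_power_Suc:
  assumes "i \<in> tidx t" "j \<in> tidx t"
  shows "(TSL t muH muA ^^ Suc m) \<rho> i j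
     = (\<Sum>k\<in>young_diagrams t CARD('d). gain k ^ Suc m * TU t DL DV b k \<rho> i j)"
proof -
  let ?R = "(TSL t muH muA ^^ Suc m) \<rho>"
  have R: "?R = twirl t muH (\<lambda>K. K) (twirl t muA normA (twirl t muH (\<lambda>K. K) ((TSL t muH muA ^^ m) \<rho>)))"
    by (simp add: TSL_eq_twirls[OF H A(1,2)])
  have "?R i j = (\<Sum>k\<in>young_diagrams t CARD('d). TU t DL DV b k ?R i j)"
    by (rule commutant_eq_TU[OF _ assms]) (simp only: R twirl_commute_SU[OF H])
  also have "\<dots> = (\<Sum>k\<in>young_diagrams t CARD('d). gain k ^ Suc m * TU t DL DV b k \<rho> i j)"
  proof (intro sum.cong refl)
    fix k assume k: "k \<in> young_diagrams t CARD('d)"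
    have "(\<Sum>l1=1..DV k. \<Sum>l2=1..DV k. block_tr k l1 l2 ?R * Pi_ll DL b k l1 l2 i j)
       = gain k ^ Suc m * (\<Sum>l1=1..DV k. \<Sum>l2=1..DV k. block_tr k l1 l2 \<rho> * Pi_ll DL b k l1 l2 i j)"
      unfolding sum_distrib_left
      by (intro sum.cong refl) (simp only: block_tr_TSL_power[OF k] mult.assoc)
    then show "TU t DL DV b k ?R i j = gain k ^ Suc m * TU t DL DV b k \<rho> i j"
      unfolding TU_block_tr by (simp only: mult.left_commute)
  qed
  finally show ?thesis .
qed

lemma optr_TSL:
  "optr t (TSL t muH muA \<rho>)
     = (\<Sum>k\<in>young_diagrams t CARD('d). gain k * optr t (opmul t \<rho> (opadj (Pi_k DL DV b k))))"
  unfolding optr_block_tr[of "TSL t muH muA \<rho>"] optr_Pi_k sum_distrib_left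
  by (intro sum.cong refl block_tr_TSL)

end

end

theorem theorem1:
  fixes muH muA :: "(complex^'d::finite^'d) measure"
    and t :: nat
    and DL DV :: "nat list \<Rightarrow> nat"
    and b :: "nat list \<Rightarrow> nat \<Rightarrow> nat \<Rightarrow> 'd tvec"
    and \<pi> :: "nat list \<Rightarrow> complex^'d^'d \<Rightarrow> nat \<Rightarrow> nat \<Rightarrow> complex"
    and \<sigma> :: "nat list \<Rightarrow> (nat \<Rightarrow> nat) \<Rightarrow> nat \<Rightarrow> nat \<Rightarrow> complex"
    and \<rho> :: "'d top"
  assumes "CARD('d) \<ge> 2" and "t \<ge> 1"
    and "schur_basis t DL DV b \<pi> \<sigma>"
    and "haar_SU muH"
    and "prob_space muA" and "sets muA = sets borel" and "AE A in muA. A \<in> Aset"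
    and "density_op t \<rho>"
  shows "(\<forall>i\<in>tidx t. \<forall>j\<in>tidx t.
            TSL t muH muA \<rho> i j =
            (\<Sum>k\<in>young_diagrams t CARD('d).
               (beta t muA DL DV b k / of_nat (DL k * DV k)) * TU t DL DV b k \<rho> i j))
       \<and> optr t (TSL t muH muA \<rho>) =
            (\<Sum>k\<in>young_diagrams t CARD('d).
               (beta t muA DL DV b k / of_nat (DL k * DV k)) * optr t (opmul t \<rho> (opadj (Pi_k DL DV b k))))
       \<and> (\<forall>m::nat. m \<ge> 1 \<longrightarrow> (\<forall>i\<in>tidx t. \<forall>j\<in>tidx t.
            ((TSL t muH muA) ^^ m) \<rho> i j =
            (\<Sum>k\<in>young_diagrams t CARD('d).
               (beta t muA DL DV b k / of_nat (DL k * DV k)) ^ m * TU t DL DV b k \<rho> i j)))"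
proof -
  interpret schur_decomposition t DL DV b \<pi> \<sigma>
    by unfold_locales (fact assms(3))
  note hyps = assms(4-7)
  have powers: "(TSL t muH muA ^^ m) \<rho> i j = (\<Sum>k\<in>young_diagrams t CARD('d).
      (beta t muA DL DV b k / of_nat (DL k * DV k)) ^ m * TU t DL DV b k \<rho> i j)"
    if "m \<ge> 1" "i \<in> tidx t" "j \<in> tidx t" for m i j
    using TSL_power_Suc[OF hyps that(2,3), of "m - 1" \<rho>] that(1) by (simp add: gain_def[OF hyps])
  show ?thesis
    \<comment> \<open>The formula for a single application is the first power.\<close>
    using powers[of 1] powers optr_TSL[OF hyps, of \<rho>] by (simp add: gain_def[OF hyps])
qed

end
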